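(* Let $\mathbb{P} = \mathbb{P}(a_0,\dots,a_n)$ be a well-formed weighted projective space. Suppose that $\gcd(a_i,a_j)=1$ for all indices $i,j$ with $a_i \neq a_j$. Then $\mu_{va}(\mathbb{P}) = 1$; that is, every ample line bundle on $\mathbb{P}$ is very ample.
   Context: For positive integers $a_0,\dots,a_n$, $\mathbb{P}(a_0,\dots,a_n) = \operatorname{Proj} k[x_0,\dots,x_n]$ over a field $k$ (one may take $k=\mathbb{C}$) with $\deg x_i = a_i$. It is well-formed if for every $i$ the gcd of all weights except $a_i$ is $1$. The Picard group of $\mathbb{P}$ is isomorphic to $\mathbb{Z}$, with ample generator $\mathcal{O}_{\mathbb{P}}(l)$, where $l = \operatorname{lcm}(a_0,\dots,a_n)$. The very ample index $\mu_{va}(\mathbb{P})$ is the smallest integer $k \ge 1$ such that $\mathcal{O}_{\mathbb{P}}(l)^{\otimes k} = \mathcal{O}_{\mathbb{P}}(kl)$ is very ample. *)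

theory Defs
  imports
    "HOL-Library.Poly_Mapping"
    "HOL-Computational_Algebra.Fraction_Field"
    "HOL-Algebra.Ideal"
    "HOL-Analysis.Abstract_Topology"
begin

section \<open>Weighted polynomial rings\<close>

type_synonym 'k mpol = "(nat \<Rightarrow>\<^sub>0 nat) \<Rightarrow>\<^sub>0 'k"

text \<open>The ring \<open>k[x\<^sub>0, ..., x\<^sub>n]\<close>, inside the polynomials in countably many variables.\<close>

definition poly_ring :: "nat \<Rightarrow> 'k::field mpol ring" where
  "poly_ring n =
     \<lparr>carrier = {f. \<forall>m \<in> Poly_Mapping.keys f. Poly_Mapping.keys m \<subseteq> {..n}},
      mult = (*), one = 1, zero = 0, add = (+)\<rparr>"

definition wdeg :: "(nat \<Rightarrow> nat) \<Rightarrow> (nat \<Rightarrow>\<^sub>0 nat) \<Rightarrow> nat" where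
  "wdeg a m = (\<Sum>i \<in> Poly_Mapping.keys m. a i * Poly_Mapping.lookup m i)"

definition graded_piece :: "nat \<Rightarrow> (nat \<Rightarrow> nat) \<Rightarrow> int \<Rightarrow> 'k::field mpol set" where
  "graded_piece n a d = {f \<in> carrier (poly_ring n). \<forall>m \<in> Poly_Mapping.keys f. int (wdeg a m) = d}"

definition hom_comp :: "(nat \<Rightarrow> nat) \<Rightarrow> int \<Rightarrow> 'k::field mpol \<Rightarrow> 'k mpol" where
  "hom_comp a d f =
     (\<Sum>m \<in> {m \<in> Poly_Mapping.keys f. int (wdeg a m) = d}. Poly_Mapping.single m (Poly_Mapping.lookup f m))"

definition irrelevant_ideal :: "nat \<Rightarrow> (nat \<Rightarrow> nat) \<Rightarrow> 'k::field mpol set" where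
  "irrelevant_ideal n a = {f \<in> carrier (poly_ring n). hom_comp a 0 f = 0}"


section \<open>Proj, its Zariski topology and the twisting sheaves\<close>

definition wproj :: "nat \<Rightarrow> (nat \<Rightarrow> nat) \<Rightarrow> 'k::field mpol set set" where
  "wproj n a = {p. primeideal p (poly_ring n) \<and>
                   (\<forall>f \<in> p. \<forall>d. hom_comp a d f \<in> p) \<and>
                   \<not> irrelevant_ideal n a \<subseteq> p}"

text \<open>
  The closed sets are \<open>V(T) = {p. T \<subseteq> p}\<close>. Arbitrary subsets \<open>T\<close> of the ring may be used in
  place of homogeneous ideals: the points are homogeneous ideals, so \<open>V(T)\<close> does not change
  if \<open>T\<close> is replaced by the ideal generated by the homogeneous components of its elements.
\<close>

definition zariski_open :: "nat \<Rightarrow> (nat \<Rightarrow> nat) \<Rightarrow> 'k::field mpol set set \<Rightarrow> bool" where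
  "zariski_open n a U \<longleftrightarrow> (\<exists>T \<subseteq> carrier (poly_ring n). U = {p \<in> wproj n a. \<not> T \<subseteq> p})"

definition zariski :: "nat \<Rightarrow> (nat \<Rightarrow> nat) \<Rightarrow> 'k::field mpol set topology" where
  "zariski n a = topology (zariski_open n a)"

text \<open>
  The stalk at \<open>p\<close> of the sheaf \<open>O(d)\<close>: the degree \<open>d\<close> part of the homogeneous localization
  of \<open>S = k[x\<^sub>0, ..., x\<^sub>n]\<close> at \<open>p\<close>. As \<open>S\<close> is a domain, the localization is taken inside a
  field of fractions. The structure sheaf is the case \<open>d = 0\<close>.
\<close>

definition stalk ::
    "nat \<Rightarrow> (nat \<Rightarrow> nat) \<Rightarrow> int \<Rightarrow> 'k::field mpol set \<Rightarrow> 'k mpol fract set" where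
  "stalk n a d p = {Fraction_Field.Fract f g | f g e.
     f \<in> graded_piece n a (e + d) \<and> g \<in> graded_piece n a e \<and> g \<notin> p}"

text \<open>
  The degree \<open>d\<close> part of the homogeneous maximal ideal of the localization at \<open>p\<close>. Where
  \<open>O(d)\<close> is invertible this is the maximal ideal of the local ring times the stalk of \<open>O(d)\<close>,
  i.e. it consists of the germs vanishing at \<open>p\<close>.
\<close>

definition vanishing_germs ::
    "nat \<Rightarrow> (nat \<Rightarrow> nat) \<Rightarrow> int \<Rightarrow> 'k::field mpol set \<Rightarrow> 'k mpol fract set" where
  "vanishing_germs n a d p = {Fraction_Field.Fract f g | f g e.
     f \<in> graded_piece n a (e + d) \<and> f \<in> p \<and> g \<in> graded_piece n a e \<and> g \<notin> p}"

definition twist_sections ::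
    "nat \<Rightarrow> (nat \<Rightarrow> nat) \<Rightarrow> int \<Rightarrow> 'k::field mpol set set \<Rightarrow> ('k mpol set \<Rightarrow> 'k mpol fract) set"
  where
  "twist_sections n a d U = {s \<in> (\<Pi>\<^sub>E p\<in>U. stalk n a d p).
     \<forall>p \<in> U. \<exists>V. openin (zariski n a) V \<and> p \<in> V \<and> V \<subseteq> U \<and>
       (\<exists>e. \<exists>f \<in> graded_piece n a (e + d). \<exists>g \<in> graded_piece n a e.
          \<forall>q \<in> V. g \<notin> q \<and> s q = Fraction_Field.Fract f g)}"


section \<open>Very ampleness\<close>

definition eval_fract :: "(nat \<Rightarrow> 'k::field mpol fract) \<Rightarrow> 'k mpol \<Rightarrow> 'k mpol fract" where
  "eval_fract v F =
     (\<Sum>m \<in> Poly_Mapping.keys F. Fraction_Field.Fract (Poly_Mapping.single 0 (Poly_Mapping.lookup F m)) 1 *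
                    (\<Prod>j \<in> Poly_Mapping.keys m. v j ^ Poly_Mapping.lookup m j))"

definition generates ::
    "nat \<Rightarrow> (nat \<Rightarrow> nat) \<Rightarrow> int \<Rightarrow> nat \<Rightarrow> (nat \<Rightarrow> 'k::field mpol set \<Rightarrow> 'k mpol fract) \<Rightarrow> bool"
  where
  "generates n a d N s \<longleftrightarrow>
     (\<forall>p \<in> wproj n a. \<forall>t \<in> stalk n a d p.
        \<exists>u. (\<forall>j\<le>N. u j \<in> stalk n a 0 p) \<and> t = (\<Sum>j\<le>N. u j * s j p))"

text \<open>
  The morphism \<open>[s\<^sub>0 : ... : s\<^sub>N]\<close> to projective \<open>N\<close>-space \<open>Proj k[y\<^sub>0, ..., y\<^sub>N]\<close> given by
  sections \<open>s\<^sub>j\<close> generating \<open>O(d)\<close>. On points, \<open>p\<close> goes to the homogeneous prime generated by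
  the homogeneous \<open>F\<close> for which the section \<open>F(s\<^sub>0, ..., s\<^sub>N)\<close> of \<open>O(d * deg F)\<close> vanishes at \<open>p\<close>;
  on the local rings at \<open>p\<close> it is \<open>F / G \<mapsto> F(s\<^sub>0, ..., s\<^sub>N) / G(s\<^sub>0, ..., s\<^sub>N)\<close>.
\<close>

definition proj_map ::
    "nat \<Rightarrow> (nat \<Rightarrow> nat) \<Rightarrow> int \<Rightarrow> nat \<Rightarrow> (nat \<Rightarrow> 'k::field mpol set \<Rightarrow> 'k mpol fract)
      \<Rightarrow> 'k mpol set \<Rightarrow> 'k mpol set" where
  "proj_map n a d N s p = {F \<in> carrier (poly_ring N).
     \<forall>e. eval_fract (\<lambda>j. s j p) (hom_comp (\<lambda>_. 1) e F) \<in> vanishing_germs n a (d * e) p}"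

definition proj_map_stalk_image ::
    "nat \<Rightarrow> (nat \<Rightarrow> nat) \<Rightarrow> int \<Rightarrow> nat \<Rightarrow> (nat \<Rightarrow> 'k::field mpol set \<Rightarrow> 'k mpol fract)
      \<Rightarrow> 'k mpol set \<Rightarrow> 'k mpol fract set" where
  "proj_map_stalk_image n a d N s p =
     {eval_fract (\<lambda>j. s j p) F / eval_fract (\<lambda>j. s j p) G | F G e.
        F \<in> graded_piece N (\<lambda>_. 1) e \<and> G \<in> graded_piece N (\<lambda>_. 1) e \<and>
        G \<notin> proj_map n a d N s p}"

text \<open>
  Closed immersion: a homeomorphism onto a closed subset that is surjective on local rings.
\<close>

definition closed_immersion ::
    "nat \<Rightarrow> (nat \<Rightarrow> nat) \<Rightarrow> int \<Rightarrow> nat \<Rightarrow> (nat \<Rightarrow> 'k::field mpol set \<Rightarrow> 'k mpol fract) \<Rightarrow> bool"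
  where
  "closed_immersion n a d N s \<longleftrightarrow>
     embedding_map (zariski n a) (zariski N (\<lambda>_. 1)) (proj_map n a d N s) \<and>
     closedin (zariski N (\<lambda>_. 1)) (proj_map n a d N s ` wproj n a) \<and>
     (\<forall>p \<in> wproj n a. stalk n a 0 p \<subseteq> proj_map_stalk_image n a d N s p)"

text \<open>
  \<open>O(d)\<close> is very ample iff finitely many global sections generate it and define a closed
  immersion into a projective space. Equivalently, \<open>O(d)\<close> is the pullback of \<open>O(1)\<close> along some
  closed immersion. The \<open>itself\<close> argument names the ground field. The definition is meant for
  invertible \<open>O(d)\<close>, in particular for \<open>d\<close> a multiple of all the weights.
\<close>

definition very_ample :: "'k::field itself \<Rightarrow> nat \<Rightarrow> (nat \<Rightarrow> nat) \<Rightarrow> int \<Rightarrow> bool" where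
  "very_ample K n a d \<longleftrightarrow>
     (\<exists>N. \<exists>s :: nat \<Rightarrow> 'k mpol set \<Rightarrow> 'k mpol fract.
        (\<forall>j\<le>N. s j \<in> twist_sections n a d (wproj n a)) \<and>
        generates n a d N s \<and> closed_immersion n a d N s)"

text \<open>
  A line bundle is ample iff some positive tensor power is very ample; for invertible \<open>O(d)\<close>
  the \<open>r\<close>-th power is \<open>O(r * d)\<close>.
\<close>

definition ample :: "'k::field itself \<Rightarrow> nat \<Rightarrow> (nat \<Rightarrow> nat) \<Rightarrow> int \<Rightarrow> bool" where
  "ample K n a d \<longleftrightarrow> (\<exists>r::nat. r \<ge> 1 \<and> very_ample K n a (int r * d))"

text \<open>The Picard group consists of the classes of the \<open>O(m * weight_lcm n a)\<close>, \<open>m\<close> an integer.\<close>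

definition weight_lcm :: "nat \<Rightarrow> (nat \<Rightarrow> nat) \<Rightarrow> nat" where
  "weight_lcm n a = Lcm (a ` {..n})"

definition mu_va :: "'k::field itself \<Rightarrow> nat \<Rightarrow> (nat \<Rightarrow> nat) \<Rightarrow> nat" where
  "mu_va K n a = (LEAST k. k \<ge> 1 \<and> very_ample K n a (int (k * weight_lcm n a)))"

text \<open>For \<open>n = 0\<close> the gcd is that of the empty set, which is \<open>0\<close>; so well-formedness forces \<open>n \<ge> 1\<close>.\<close>

definition well_formed :: "nat \<Rightarrow> (nat \<Rightarrow> nat) \<Rightarrow> bool" where
  "well_formed n a \<longleftrightarrow> (\<forall>i\<le>n. Gcd (a ` ({..n} - {i})) = 1)"


section \<open>The Zariski topology is a topology\<close>

lemma zero_mem_wproj: "p \<in> wproj n a \<Longrightarrow> 0 \<in> p"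
proof -
  assume "p \<in> wproj n a"
  then interpret primeideal p "poly_ring n" by (simp add: wproj_def)
  show "0 \<in> p" using additive_subgroup.zero_closed[OF additive_subgroup_axioms]
    by (simp add: poly_ring_def)
qed

lemma istopology_zariski: "istopology (zariski_open n a :: 'k::field mpol set set \<Rightarrow> bool)"
  unfolding istopology_def
proof (intro conjI allI impI)
  fix U V :: "'k mpol set set"
  assume "zariski_open n a U" "zariski_open n a V"
  then obtain T T' where T: "T \<subseteq> carrier (poly_ring n)" and U: "U = {p \<in> wproj n a. \<not> T \<subseteq> p}"
    and T': "T' \<subseteq> carrier (poly_ring n)" and V: "V = {p \<in> wproj n a. \<not> T' \<subseteq> p}"
    unfolding zariski_open_def by (elim exE conjE)
  define P where "P = {f * g | f g. f \<in> T \<and> g \<in> T'} \<inter> carrier (poly_ring n)"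
  have *: "(\<not> T \<subseteq> p \<and> \<not> T' \<subseteq> p) \<longleftrightarrow> \<not> P \<subseteq> p" if p: "p \<in> wproj n a" for p
  proof -
    interpret primeideal p "poly_ring n" using p by (simp add: wproj_def)
    have mul: "x \<otimes>\<^bsub>poly_ring n\<^esub> y = x * y" for x y :: "'k mpol" by (simp add: poly_ring_def)
    show ?thesis
    proof
      assume "\<not> T \<subseteq> p \<and> \<not> T' \<subseteq> p"
      then obtain f g where fg: "f \<in> T" "f \<notin> p" "g \<in> T'" "g \<notin> p" by (elim conjE) (meson subsetI)
      have c: "f \<in> carrier (poly_ring n)" "g \<in> carrier (poly_ring n)"
        using fg T T' by (meson subsetD)+
      have "f * g \<notin> p" using I_prime[OF c] fg unfolding mul by (meson)
      moreover have "f * g \<in> P" using m_closed[OF c] fg unfolding P_def mul by blast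
      ultimately show "\<not> P \<subseteq> p" by (meson subsetD)
    next
      assume "\<not> P \<subseteq> p"
      then obtain f g where fg: "f \<in> T" "g \<in> T'" "f * g \<notin> p" unfolding P_def by auto
      have c: "f \<in> carrier (poly_ring n)" "g \<in> carrier (poly_ring n)"
        using fg T T' by (meson subsetD)+
      have "f \<notin> p" "g \<notin> p"
        using I_r_closed[OF _ c(2), of f] I_l_closed[OF _ c(1), of g] fg(3) unfolding mul by meson+
      then show "\<not> T \<subseteq> p \<and> \<not> T' \<subseteq> p" using fg by (meson subsetD)
    qed
  qed
  have "U \<inter> V = {p \<in> wproj n a. \<not> P \<subseteq> p}"
    unfolding U V using * by (intro Set.set_eqI) (simp, meson)
  moreover have "P \<subseteq> carrier (poly_ring n)" unfolding P_def by (rule Int_lower2)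
  ultimately show "zariski_open n a (U \<inter> V)" unfolding zariski_open_def by (intro exI conjI)
next
  fix K :: "'k mpol set set set"
  assume "\<forall>U\<in>K. zariski_open n a U"
  then obtain T where T: "\<And>U. U \<in> K \<Longrightarrow> T U \<subseteq> carrier (poly_ring n)"
    and U: "\<And>U. U \<in> K \<Longrightarrow> U = {p \<in> wproj n a. \<not> T U \<subseteq> p}"
    unfolding zariski_open_def by (drule_tac bchoice) blast
  have mem: "p \<in> U \<longleftrightarrow> p \<in> wproj n a \<and> \<not> T U \<subseteq> p" if "U \<in> K" for p U
    by (subst U[OF that]) simp
  have "\<Union>K = {p \<in> wproj n a. \<not> (\<Union>U\<in>K. T U) \<subseteq> p}"
    using mem by (intro Set.set_eqI, unfold Union_iff mem_Collect_eq UN_subset_iff) meson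
  moreover have "(\<Union>U\<in>K. T U) \<subseteq> carrier (poly_ring n)" using T by (rule UN_least)
  ultimately show "zariski_open n a (\<Union>K)" unfolding zariski_open_def by (intro exI conjI)
qed

lemma openin_zariski: "openin (zariski n a) U \<longleftrightarrow> zariski_open n a U"
  by (simp add: zariski_def istopology_zariski)

lemma topspace_zariski: "topspace (zariski n a) = wproj n a"
proof -
  have "1 \<notin> p" if "p \<in> wproj n a" for p :: "'a mpol set"
  proof -
    interpret primeideal p "poly_ring n" using that by (simp add: wproj_def)
    show ?thesis using one_imp_carrier I_notcarr by (auto simp: poly_ring_def)
  qed
  moreover have "(1 :: 'a mpol) \<in> carrier (poly_ring n)" by (simp add: poly_ring_def)
  ultimately have "zariski_open n a (wproj n a :: 'a mpol set set)"
    unfolding zariski_open_def by (intro exI[of _ "{1}"]) auto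
  moreover have "U \<subseteq> wproj n a" if "zariski_open n a U" for U :: "'a mpol set set"
    using that by (auto simp: zariski_open_def)
  ultimately show ?thesis unfolding topspace_def openin_zariski by blast
qed

end

theory Submission
  imports Defs
begin

text \<open>
  Let \<open>d\<close> be a positive multiple of all the weights with \<open>a\<^sub>i a\<^sub>j \<le> d\<close> whenever \<open>a\<^sub>i \<noteq> a\<^sub>j\<close>; for
  pairwise equal or coprime weights, the multiples of the lcm have this property. Embed by all the
  monomials of degree \<open>d\<close>. The key point is combinatorial: a nonconstant monomial whose degree is
  divisible by \<open>a\<^sub>i\<close> has a nonconstant factor of degree divisible by \<open>a\<^sub>i\<close> and at most \<open>d\<close>: either a
  variable of weight \<open>a\<^sub>i\<close>, or, as any \<open>a\<^sub>i\<close> integers have a nonempty subsum divisible by \<open>a\<^sub>i\<close>, a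
  product of at most \<open>a\<^sub>i\<close> variables of weight at most \<open>d / a\<^sub>i\<close>. Filling up such factors with powers
  of \<open>x\<^sub>i\<close> shows that on the chart \<open>x\<^sub>i \<noteq> 0\<close> every element of degree divisible by \<open>a\<^sub>i\<close> is, up to a power of
  \<open>x\<^sub>i\<close>, a polynomial in the chosen monomials. This yields surjectivity on local rings,
  injectivity and closedness. In negative degree there are no nonzero sections, as a section
  has powers of \<open>x\<^sub>0\<close> and of \<open>x\<^sub>1\<close> as denominators; so nonpositive degrees need no
  embedding.
\<close>

section \<open>Graded pieces\<close>

lemma poly_ring_simps [simp]:
  "mult (poly_ring n) = (*)" "one (poly_ring n) = 1" "zero (poly_ring n) = 0" "add (poly_ring n) = (+)"
  by (simp_all add: poly_ring_def)

lemma carrier_poly_ring_iff: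
  "f \<in> carrier (poly_ring n) \<longleftrightarrow> (\<forall>m \<in> Poly_Mapping.keys f. Poly_Mapping.keys m \<subseteq> {..n})"
  by (simp add: poly_ring_def)

lemma poly_ring_add: "f \<in> carrier (poly_ring n) \<Longrightarrow> g \<in> carrier (poly_ring n) \<Longrightarrow> f + g \<in> carrier (poly_ring n)"
  using Poly_Mapping.keys_add[of f g] by (auto simp: carrier_poly_ring_iff)

lemma keys_add_nat: "Poly_Mapping.keys (m + m' :: nat \<Rightarrow>\<^sub>0 nat) = Poly_Mapping.keys m \<union> Poly_Mapping.keys m'"
  by (auto simp: in_keys_iff lookup_add)

lemma poly_ring_mult: "f \<in> carrier (poly_ring n) \<Longrightarrow> g \<in> carrier (poly_ring n) \<Longrightarrow> f * g \<in> carrier (poly_ring n)"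
  using keys_mult[of f g] by (fastforce simp: carrier_poly_ring_iff keys_add_nat)

lemma keys_uminus: "Poly_Mapping.keys (- f) = Poly_Mapping.keys (f :: 'a \<Rightarrow>\<^sub>0 'k::ab_group_add)"
  by (auto simp: in_keys_iff)

lemma poly_ring_uminus: "f \<in> carrier (poly_ring n) \<Longrightarrow> - f \<in> carrier (poly_ring n)"
  by (simp add: carrier_poly_ring_iff keys_uminus)

lemma poly_ring_zero: "0 \<in> carrier (poly_ring n)" and poly_ring_one: "1 \<in> carrier (poly_ring n)"
  by (simp_all add: carrier_poly_ring_iff)

lemma poly_ring_single: "Poly_Mapping.keys m \<subseteq> {..n} \<Longrightarrow> Poly_Mapping.single m c \<in> carrier (poly_ring n)"
  by (simp add: carrier_poly_ring_iff)

lemma poly_ring_diff: "f \<in> carrier (poly_ring n) \<Longrightarrow> g \<in> carrier (poly_ring n) \<Longrightarrow> f - g \<in> carrier (poly_ring n)"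
  using poly_ring_add[OF _ poly_ring_uminus, of f n g] by simp

lemma poly_ring_power: "f \<in> carrier (poly_ring n) \<Longrightarrow> f ^ k \<in> carrier (poly_ring n)"
  by (induction k) (auto intro: poly_ring_mult poly_ring_one)

lemma poly_ring_sum: "(\<And>i. i \<in> A \<Longrightarrow> f i \<in> carrier (poly_ring n)) \<Longrightarrow> sum f A \<in> carrier (poly_ring n)"
  by (induction A rule: infinite_finite_induct) (auto intro: poly_ring_add poly_ring_zero)

lemma cring_poly_ring: "cring (poly_ring n :: 'k::field mpol ring)"
proof (rule cringI)
  show "abelian_group (poly_ring n :: 'k mpol ring)"
  proof (rule abelian_groupI)
    fix f :: "'k mpol" assume "f \<in> carrier (poly_ring n)"
    then show "\<exists>y\<in>carrier (poly_ring n). y \<oplus>\<^bsub>poly_ring n\<^esub> f = \<zero>\<^bsub>poly_ring n\<^esub>"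
      by (intro bexI[of _ "- f"]) (auto intro: poly_ring_uminus)
  qed (auto intro: poly_ring_add poly_ring_zero simp: algebra_simps)
  show "Group.comm_monoid (poly_ring n :: 'k mpol ring)"
    by (rule comm_monoidI) (auto intro: poly_ring_mult poly_ring_one simp: algebra_simps)
qed (simp add: algebra_simps)

section \<open>Weighted degrees of monomials and homogeneous polynomials\<close>

lemma wdeg_superset:
  "finite A \<Longrightarrow> Poly_Mapping.keys m \<subseteq> A \<Longrightarrow> wdeg a m = (\<Sum>i\<in>A. a i * Poly_Mapping.lookup m i)"
  unfolding wdeg_def by (rule sum.mono_neutral_left) (auto simp: in_keys_iff)

lemma wdeg_add: "wdeg a (m + m') = wdeg a m + wdeg a m'"
proof -
  let ?A = "Poly_Mapping.keys m \<union> Poly_Mapping.keys m'"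
  have "wdeg a x = (\<Sum>i\<in>?A. a i * Poly_Mapping.lookup x i)" if "x \<in> {m, m', m + m'}" for x
    using that by (intro wdeg_superset) (auto simp: keys_add_nat)
  then show ?thesis by (simp add: lookup_add algebra_simps sum.distrib)
qed

lemma wdeg_zero [simp]: "wdeg a 0 = 0"
  by (simp add: wdeg_def)

lemma wdeg_single [simp]: "wdeg a (Poly_Mapping.single i k) = a i * k"
  by (cases "k = 0") (auto simp: wdeg_def)

lemma wdeg_of_nat_mult: "wdeg a (of_nat k * m) = k * wdeg a m"
  by (induction k) (auto simp: wdeg_add algebra_simps)

lemma wdeg_sum: "wdeg a (sum f A) = (\<Sum>i\<in>A. wdeg a (f i))"
  by (induction A rule: infinite_finite_induct) (auto simp: wdeg_add)

lemma mult_lookup_le_wdeg: "a i * Poly_Mapping.lookup m i \<le> wdeg a m"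
  by (cases "i \<in> Poly_Mapping.keys m") (auto simp: wdeg_def in_keys_iff intro: member_le_sum)

lemma wdeg_eq_0:
  assumes "wdeg a m = 0" "Poly_Mapping.keys m \<subseteq> {..n}" "\<forall>i\<le>n. a i > 0"
  shows "m = 0"
proof (rule poly_mapping_eqI)
  fix i show "Poly_Mapping.lookup m i = Poly_Mapping.lookup 0 i"
    using mult_lookup_le_wdeg[of a i m] assms by (cases "i \<le> n") (auto simp: in_keys_iff)
qed

lemma graded_piece_iff:
  "f \<in> graded_piece n a D \<longleftrightarrow> f \<in> carrier (poly_ring n) \<and> (\<forall>m\<in>Poly_Mapping.keys f. int (wdeg a m) = D)"
  by (simp add: graded_piece_def)

lemma graded_piece_carrier: "f \<in> graded_piece n a D \<Longrightarrow> f \<in> carrier (poly_ring n)"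
  by (simp add: graded_piece_iff)

lemma graded_piece_add: "f \<in> graded_piece n a D \<Longrightarrow> g \<in> graded_piece n a D \<Longrightarrow> f + g \<in> graded_piece n a D"
  using Poly_Mapping.keys_add[of f g] by (auto simp: graded_piece_iff poly_ring_add)

lemma graded_piece_zero: "0 \<in> graded_piece n a D" and graded_piece_one: "1 \<in> graded_piece n a 0"
  by (simp_all add: graded_piece_iff poly_ring_zero poly_ring_one)

lemma graded_piece_mult:
  assumes "f \<in> graded_piece n a D" "g \<in> graded_piece n a E"
  shows "f * g \<in> graded_piece n a (D + E)"
  using assms keys_mult[of f g] by (fastforce simp: graded_piece_iff poly_ring_mult wdeg_add)

lemma graded_piece_power: "f \<in> graded_piece n a D \<Longrightarrow> f ^ k \<in> graded_piece n a (int k * D)"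
proof (induction k)
  case (Suc k)
  then show ?case using graded_piece_mult[of f n a D "f ^ k" "int k * D"] by (simp add: algebra_simps)
qed (simp add: graded_piece_one)

lemma graded_piece_single:
  "Poly_Mapping.keys m \<subseteq> {..n} \<Longrightarrow> int (wdeg a m) = D \<Longrightarrow> Poly_Mapping.single m c \<in> graded_piece n a D"
  by (simp add: graded_piece_iff poly_ring_single)

lemma graded_piece_sum: "(\<And>i. i \<in> A \<Longrightarrow> f i \<in> graded_piece n a D) \<Longrightarrow> sum f A \<in> graded_piece n a D"
  by (induction A rule: infinite_finite_induct) (auto intro: graded_piece_add graded_piece_zero)

lemma graded_piece_neg: "f \<in> graded_piece n a D \<Longrightarrow> D < 0 \<Longrightarrow> f = 0"
  by (metis equals0I graded_piece_iff keys_eq_empty of_nat_0_le_iff not_less)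

section \<open>Homogeneous components\<close>

lemma lookup_hom_comp:
  "Poly_Mapping.lookup (hom_comp a D f) m = (Poly_Mapping.lookup f m when int (wdeg a m) = D)"
proof -
  have "Poly_Mapping.lookup (hom_comp a D f) m =
    (\<Sum>x \<in> {x \<in> Poly_Mapping.keys f. int (wdeg a x) = D}. if x = m then Poly_Mapping.lookup f m else 0)"
    by (auto simp: hom_comp_def lookup_sum lookup_single when_def intro!: sum.cong)
  also have "\<dots> = (Poly_Mapping.lookup f m when int (wdeg a m) = D)"
    by (simp add: sum.delta when_def in_keys_iff)
  finally show ?thesis .
qed

lemma keys_hom_comp: "Poly_Mapping.keys (hom_comp a D f) = {m \<in> Poly_Mapping.keys f. int (wdeg a m) = D}"
  by (auto simp: in_keys_iff lookup_hom_comp)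

lemma hom_comp_carrier: "f \<in> carrier (poly_ring n) \<Longrightarrow> hom_comp a D f \<in> carrier (poly_ring n)"
  by (auto simp: carrier_poly_ring_iff keys_hom_comp)

lemma hom_comp_graded: "f \<in> carrier (poly_ring n) \<Longrightarrow> hom_comp a D f \<in> graded_piece n a D"
  by (auto simp: graded_piece_iff hom_comp_carrier keys_hom_comp)

lemma hom_comp_add: "hom_comp a D (f + g) = hom_comp a D f + hom_comp a D g"
  by (rule poly_mapping_eqI) (simp add: lookup_hom_comp lookup_add when_add_distrib)

lemma hom_comp_zero [simp]: "hom_comp a D 0 = 0"
  by (simp add: hom_comp_def)

lemma hom_comp_sum: "hom_comp a D (sum f A) = (\<Sum>i\<in>A. hom_comp a D (f i))"
  by (induction A rule: infinite_finite_induct) (auto simp: hom_comp_add)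

lemma hom_comp_of_graded:
  "f \<in> graded_piece n a E \<Longrightarrow> hom_comp a D f = (if D = E then f else 0)"
  by (rule poly_mapping_eqI) (auto simp: lookup_hom_comp graded_piece_iff in_keys_iff when_def)

lemma hom_comp_eq_0: "(\<And>m. m \<in> Poly_Mapping.keys f \<Longrightarrow> int (wdeg a m) \<noteq> D) \<Longrightarrow> hom_comp a D f = 0"
  by (rule poly_mapping_eqI) (auto simp: lookup_hom_comp in_keys_iff when_def)

lemma sum_hom_comp: "(\<Sum>D \<in> (\<lambda>m. int (wdeg a m)) ` Poly_Mapping.keys f. hom_comp a D f) = f"
proof (rule poly_mapping_eqI)
  fix m
  show "Poly_Mapping.lookup (\<Sum>D \<in> (\<lambda>m. int (wdeg a m)) ` Poly_Mapping.keys f. hom_comp a D f) m = Poly_Mapping.lookup f m"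
    by (auto simp: lookup_sum lookup_hom_comp when_def sum.delta in_keys_iff)
qed

text \<open>Decompose \<open>f\<close> into components: the one of degree \<open>i\<close> times
  \<open>g\<close> is homogeneous of degree \<open>i + E\<close>, so only \<open>i = D - E\<close>
  contributes.\<close>

lemma hom_comp_mult_graded:
  assumes "f \<in> carrier (poly_ring n)" "g \<in> graded_piece n a E"
  shows "hom_comp a D (f * g) = hom_comp a (D - E) f * g"
proof -
  let ?I = "(\<lambda>m. int (wdeg a m)) ` Poly_Mapping.keys f"
  have "hom_comp a D (f * g) = hom_comp a D ((\<Sum>i\<in>?I. hom_comp a i f) * g)"
    by (simp only: sum_hom_comp)
  also have "\<dots> = (\<Sum>i\<in>?I. hom_comp a D (hom_comp a i f * g))"
    by (simp add: sum_distrib_right hom_comp_sum)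
  also have "\<dots> = (\<Sum>i\<in>?I. if i = D - E then hom_comp a (D - E) f * g else 0)"
  proof (rule sum.cong[OF refl])
    fix i
    have "hom_comp a i f * g \<in> graded_piece n a (i + E)"
      using graded_piece_mult[OF hom_comp_graded[OF assms(1)] assms(2)] .
    then show "hom_comp a D (hom_comp a i f * g) = (if i = D - E then hom_comp a (D - E) f * g else 0)"
      by (auto simp: hom_comp_of_graded)
  qed
  also have "\<dots> = hom_comp a (D - E) f * g"
  proof -
    \<comment> \<open>The index set contains only degrees that occur in \<open>f\<close>; if
      \<open>D - E\<close> is not among them, both sides vanish.\<close>
    have "hom_comp a (D - E) f = 0" if "D - E \<notin> ?I"
      using that by (intro hom_comp_eq_0) force
    then show ?thesis by (auto simp: sum.delta)
  qed
  finally show ?thesis .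
qed

lemma graded_pieceI:
  assumes "f \<in> carrier (poly_ring n)" "\<And>E. E \<noteq> D \<Longrightarrow> hom_comp a E f = 0"
  shows "f \<in> graded_piece n a D"
  unfolding graded_piece_iff
proof (intro conjI ballI assms(1), rule ccontr)
  fix m assume m: "m \<in> Poly_Mapping.keys f" "int (wdeg a m) \<noteq> D"
  with assms(2)[OF m(2)] have "Poly_Mapping.lookup (hom_comp a (int (wdeg a m)) f) m = 0" by simp
  with m show False by (simp add: lookup_hom_comp in_keys_iff)
qed

section \<open>Points of Proj\<close>

text \<open>The prime ideal axioms in terms of \<open>+\<close> and \<open>*\<close>, so that later
  arguments use membership alone and need not interpret \<open>primeideal\<close>.\<close>

lemma wproj_subset: "p \<in> wproj n a \<Longrightarrow> p \<subseteq> carrier (poly_ring n)"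
  and wproj_add: "p \<in> wproj n a \<Longrightarrow> f \<in> p \<Longrightarrow> g \<in> p \<Longrightarrow> f + g \<in> p"
  and wproj_mult: "p \<in> wproj n a \<Longrightarrow> f \<in> p \<Longrightarrow> g \<in> carrier (poly_ring n) \<Longrightarrow> f * g \<in> p"
  and wproj_prime: "p \<in> wproj n a \<Longrightarrow> f \<in> carrier (poly_ring n) \<Longrightarrow> g \<in> carrier (poly_ring n) \<Longrightarrow>
    f * g \<in> p \<Longrightarrow> f \<in> p \<or> g \<in> p"
  and wproj_one: "p \<in> wproj n a \<Longrightarrow> 1 \<notin> p"
  and wproj_hom_comp: "p \<in> wproj n a \<Longrightarrow> f \<in> p \<Longrightarrow> hom_comp a D f \<in> p"
proof -
  assume p: "p \<in> wproj n a"
  then interpret primeideal p "poly_ring n" by (simp add: wproj_def)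
  show "p \<subseteq> carrier (poly_ring n)" by (rule a_subset)
  show "f \<in> p \<Longrightarrow> g \<in> p \<Longrightarrow> f + g \<in> p"
    using additive_subgroup.a_closed[OF additive_subgroup_axioms, of f g] by simp
  show "f \<in> p \<Longrightarrow> g \<in> carrier (poly_ring n) \<Longrightarrow> f * g \<in> p"
    using I_r_closed[of f g] by simp
  show "f \<in> carrier (poly_ring n) \<Longrightarrow> g \<in> carrier (poly_ring n) \<Longrightarrow> f * g \<in> p \<Longrightarrow> f \<in> p \<or> g \<in> p"
    using I_prime[of f g] by simp
  show "1 \<notin> p" using one_imp_carrier I_notcarr by auto
  show "f \<in> p \<Longrightarrow> hom_comp a D f \<in> p" using p by (auto simp: wproj_def)
qed

lemma wproj_sum: "p \<in> wproj n a \<Longrightarrow> (\<And>i. i \<in> A \<Longrightarrow> f i \<in> p) \<Longrightarrow> sum f A \<in> p"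
  by (induction A rule: infinite_finite_induct) (auto intro: wproj_add zero_mem_wproj)

text \<open>Points are homogeneous ideals, and an element is the finite sum of its
  components.\<close>

lemma wproj_hom_comp_iff:
  assumes "p \<in> wproj n a"
  shows "f \<in> p \<longleftrightarrow> (\<forall>D. hom_comp a D f \<in> p)"
  using wproj_hom_comp[OF assms] wproj_sum[OF assms, of _ "\<lambda>D. hom_comp a D f"]
  by (metis sum_hom_comp)

lemma wproj_power: 
  assumes p: "p \<in> wproj n a" and f: "f \<in> carrier (poly_ring n)" 
  shows "f ^ k \<in> p \<Longrightarrow> f \<in> p"
proof (induction k)
  case 0 then show ?case using wproj_one[OF p] by simp
next
  case (Suc k) then show ?case using wproj_prime[OF p f poly_ring_power[OF f]] by auto
qed

section \<open>Variables and the charts where they do not vanish\<close>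

abbreviation var :: "nat \<Rightarrow> 'k::field mpol" where
  "var i \<equiv> Poly_Mapping.single (Poly_Mapping.single i 1) 1"

lemma var_carrier: "i \<le> n \<Longrightarrow> var i \<in> carrier (poly_ring n)"
  by (simp add: poly_ring_single)

lemma single_power: "Poly_Mapping.single m c ^ k = Poly_Mapping.single (of_nat k * m :: nat \<Rightarrow>\<^sub>0 nat) (c ^ k :: 'k::field)"
  by (induction k) (auto simp: mult_single algebra_simps)

lemma of_nat_mult_single: "of_nat k * Poly_Mapping.single i c = (Poly_Mapping.single i (k * c) :: nat \<Rightarrow>\<^sub>0 nat)"
  by (induction k) (auto simp: algebra_simps single_add)

lemma var_power: "var i ^ k = Poly_Mapping.single (Poly_Mapping.single i k) 1"
  by (simp add: single_power of_nat_mult_single)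

lemma var_power_graded: "i \<le> n \<Longrightarrow> D = int (a i * k) \<Longrightarrow> var i ^ k \<in> graded_piece n a D"
  unfolding var_power by (rule graded_piece_single) auto

lemma var_power_nonzero: "(var i :: 'k::field mpol) ^ k \<noteq> 0"
  unfolding var_power by (metis inj_single lookup_single_eq lookup_zero zero_neq_one)

lemma single_eq_mult_var:
  assumes "i \<in> Poly_Mapping.keys (m :: nat \<Rightarrow>\<^sub>0 nat)"
  obtains m' where "m = Poly_Mapping.single i 1 + m'"
proof 
  show "m = Poly_Mapping.single i 1 + (m - Poly_Mapping.single i 1)"
    using assms by (intro poly_mapping_eqI) (auto simp: lookup_add lookup_minus lookup_single in_keys_iff when_def)
qed

lemma poly_mapping_single_sum:
  "f = (\<Sum>m\<in>Poly_Mapping.keys f. Poly_Mapping.single m (Poly_Mapping.lookup f m))"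
  by (rule poly_mapping_eqI)
    (auto simp: lookup_sum lookup_single when_def in_keys_iff sum.delta)

text \<open>A prime containing all variables contains every nonconstant monomial, hence the
  irrelevant ideal. So the charts \<open>x_i \<noteq> 0\<close> cover Proj, and later arguments fix
  one of them.\<close>

lemma wproj_var:
  assumes p: "p \<in> wproj n a"
  obtains i where "i \<le> n" "var i \<notin> p"
proof -
  have False if v: "\<forall>i\<le>n. var i \<in> p"
  proof -
    have "f \<in> p" if f: "f \<in> irrelevant_ideal n a" for f
    proof (subst poly_mapping_single_sum, rule wproj_sum[OF p])
      fix m assume m: "m \<in> Poly_Mapping.keys f"
      \<comment> \<open>The constant monomial has degree 0, where \<open>f\<close> has no
        component.\<close>
      have "m \<noteq> 0"
      proof
        assume "m = 0"
        then have "Poly_Mapping.lookup (hom_comp a 0 f) 0 = Poly_Mapping.lookup f 0"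
          by (simp add: lookup_hom_comp)
        then show False using f m \<open>m = 0\<close> by (simp add: irrelevant_ideal_def in_keys_iff)
      qed
      then obtain i where i: "i \<in> Poly_Mapping.keys m" by (metis all_not_in_conv keys_eq_empty)
      then obtain m' where m': "m = Poly_Mapping.single i 1 + m'" by (rule single_eq_mult_var)
      have km: "Poly_Mapping.keys m \<subseteq> {..n}"
        using f m by (auto simp: irrelevant_ideal_def carrier_poly_ring_iff)
      have "var i * Poly_Mapping.single m' (Poly_Mapping.lookup f m) \<in> p"
        using v i km m' by (intro wproj_mult[OF p]) (auto simp: keys_add_nat intro!: poly_ring_single)
      then show "Poly_Mapping.single m (Poly_Mapping.lookup f m) \<in> p"
        by (simp add: mult_single m'[symmetric] del: One_nat_def)
    qed
    then show False using p by (auto simp: wproj_def)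
  qed
  then show ?thesis using that by blast
qed

lemma wproj_var_not_in:
  assumes "p \<in> wproj n a" "i \<le> n" "var i \<notin> p" "f \<in> carrier (poly_ring n)" "f * var i ^ k \<in> p"
  shows "f \<in> p"
  using assms wproj_prime[OF assms(1,4) poly_ring_power[OF var_carrier[OF assms(2)]]]
    wproj_power[OF assms(1) var_carrier[OF assms(2)]] by blast

section \<open>Criteria for homogeneous primes\<close>

text \<open>If the product lies in the ideal, so does the product of the top components, hence one of them can be split off.\<close>

lemma homogeneous_primeI:
  fixes p :: "'k::field mpol set"
  assumes sub: "p \<subseteq> carrier (poly_ring n)"
    and add: "\<And>f g. f \<in> p \<Longrightarrow> g \<in> p \<Longrightarrow> f + g \<in> p"
    and mult: "\<And>f g. f \<in> p \<Longrightarrow> g \<in> carrier (poly_ring n) \<Longrightarrow> f * g \<in> p"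
    and hom: "\<And>f D. f \<in> p \<Longrightarrow> hom_comp a D f \<in> p"
    and prime: "\<And>f g D E. f \<in> graded_piece n a D \<Longrightarrow> g \<in> graded_piece n a E \<Longrightarrow> f * g \<in> p \<Longrightarrow> f \<in> p \<or> g \<in> p"
    and zero: "0 \<in> p"
  shows "f \<in> carrier (poly_ring n) \<Longrightarrow> g \<in> carrier (poly_ring n) \<Longrightarrow> f * g \<in> p \<Longrightarrow> f \<in> p \<or> g \<in> p"
proof (induction "card (Poly_Mapping.keys f) + card (Poly_Mapping.keys g)" arbitrary: f g rule: less_induct)
  case less
  have uminus: "- h \<in> p" if "h \<in> p" for h
    using mult[OF that poly_ring_uminus[OF poly_ring_one]] by simp
  show ?case
  proof (cases "f = 0 \<or> g = 0")
    case True then show ?thesis using zero by auto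
  next
    case False
    define top where "top h = Max ((\<lambda>m. int (wdeg a m)) ` Poly_Mapping.keys h)" for h :: "'k mpol"
    have top_le: "int (wdeg a m) \<le> top h" if "m \<in> Poly_Mapping.keys h" for m h
      using that unfolding top_def by (intro Max_ge) auto
    have top_card: "card (Poly_Mapping.keys (h - hom_comp a (top h) h)) < card (Poly_Mapping.keys h)" if "h \<noteq> 0" for h
    proof -
      have "top h \<in> (\<lambda>m. int (wdeg a m)) ` Poly_Mapping.keys h"
        using that unfolding top_def by (intro Max_in) auto
      then obtain m where m: "m \<in> Poly_Mapping.keys h" "int (wdeg a m) = top h" by auto
      have "Poly_Mapping.keys (h - hom_comp a (top h) h) \<subseteq> Poly_Mapping.keys h - {m}"
        using m by (auto simp: in_keys_iff lookup_minus lookup_hom_comp when_def split: if_splits)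
      then have "card (Poly_Mapping.keys (h - hom_comp a (top h) h)) \<le> card (Poly_Mapping.keys h - {m})"
        by (intro card_mono) auto
      then show ?thesis using m(1) by (metis card_Diff1_less finite_keys le_less_trans)
    qed
    have rest: "int (wdeg a m) < top h" if "m \<in> Poly_Mapping.keys (h - hom_comp a (top h) h)" for m h
      using that top_le[of m h]
      by (auto simp: in_keys_iff lookup_minus lookup_hom_comp when_def split: if_splits)
    define f1 g1 where "f1 = hom_comp a (top f) f" and "g1 = hom_comp a (top g) g"
    have f1: "f1 \<in> graded_piece n a (top f)" and g1: "g1 \<in> graded_piece n a (top g)"
      unfolding f1_def g1_def using less.prems by (auto intro: hom_comp_graded)
    \<comment> \<open>The other two summands of \<open>f * g\<close> live in degrees below
      \<open>top f + top g\<close>, so \<open>f1 * g1\<close> is a full component of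
      \<open>f * g\<close> and lies in \<open>p\<close>.\<close>
    have low: "hom_comp a (top f + top g) ((f - f1) * g) = 0" "hom_comp a (top f + top g) (f1 * (g - g1)) = 0"
    proof -
      show "hom_comp a (top f + top g) ((f - f1) * g) = 0"
      proof (rule hom_comp_eq_0)
        fix m assume "m \<in> Poly_Mapping.keys ((f - f1) * g)"
        then obtain u v where "m = u + v" "u \<in> Poly_Mapping.keys (f - f1)" "v \<in> Poly_Mapping.keys g"
          using keys_mult[of "f - f1" g] by auto
        then show "int (wdeg a m) \<noteq> top f + top g"
          using rest[of u f] top_le[of v g] by (simp add: f1_def wdeg_add)
      qed
      show "hom_comp a (top f + top g) (f1 * (g - g1)) = 0"
      proof (rule hom_comp_eq_0)
        fix m assume "m \<in> Poly_Mapping.keys (f1 * (g - g1))"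
        then obtain u v where "m = u + v" "u \<in> Poly_Mapping.keys f1" "v \<in> Poly_Mapping.keys (g - g1)"
          using keys_mult[of f1 "g - g1"] by auto
        then show "int (wdeg a m) \<noteq> top f + top g"
          using rest[of v g] f1 by (auto simp: g1_def wdeg_add graded_piece_iff)
      qed
    qed
    have "f * g = f1 * g1 + ((f - f1) * g + f1 * (g - g1))" by (simp add: algebra_simps)
    then have "hom_comp a (top f + top g) (f * g) = hom_comp a (top f + top g) (f1 * g1)"
      by (simp add: hom_comp_add low)
    also have "\<dots> = f1 * g1"
      using hom_comp_of_graded[OF graded_piece_mult[OF f1 g1]] by simp
    finally have "f1 * g1 \<in> p" using hom[OF less.prems(3)] by metis
    then consider "f1 \<in> p" | "g1 \<in> p" using prime[OF f1 g1] by blast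
    then show ?thesis
    proof cases
      case 1
      \<comment> \<open>Removing a component in \<open>p\<close> keeps the product in
        \<open>p\<close> and lowers the number of terms, so the induction hypothesis
        applies.\<close>
      have "(f - f1) * g = f * g + - (f1 * g)" by (simp add: algebra_simps)
      then have "(f - f1) * g \<in> p" using add[OF less.prems(3) uminus[OF mult[OF 1 less.prems(2)]]] by simp
      then have "f - f1 \<in> p \<or> g \<in> p"
        using less.hyps[of "f - f1" g] top_card[of f] False less.prems graded_piece_carrier[OF f1]
        by (auto simp: f1_def intro: poly_ring_diff)
      then show ?thesis using add[OF _ 1] by force
    next
      case 2
      have "f * (g - g1) = f * g + - (g1 * f)" by (simp add: algebra_simps)
      then have "f * (g - g1) \<in> p" using add[OF less.prems(3) uminus[OF mult[OF 2 less.prems(1)]]] by simp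
      then have "f \<in> p \<or> g - g1 \<in> p"
        using less.hyps[of f "g - g1"] top_card[of g] False less.prems graded_piece_carrier[OF g1]
        by (auto simp: g1_def intro: poly_ring_diff)
      then show ?thesis using add[OF _ 2] by force
    qed
  qed
qed

text \<open>Primality has to be checked on homogeneous elements only, and a variable of positive
  weight outside \<open>p\<close> keeps \<open>p\<close> from containing the irrelevant
  ideal.\<close>

lemma wprojI:
  fixes p :: "'k::field mpol set"
  assumes sub: "p \<subseteq> carrier (poly_ring n)" and zero: "0 \<in> p"
    and add: "\<And>f g. f \<in> p \<Longrightarrow> g \<in> p \<Longrightarrow> f + g \<in> p"
    and mult: "\<And>f g. f \<in> p \<Longrightarrow> g \<in> carrier (poly_ring n) \<Longrightarrow> f * g \<in> p"
    and hom: "\<And>f D. f \<in> p \<Longrightarrow> hom_comp a D f \<in> p"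
    and prime: "\<And>f g D E. f \<in> graded_piece n a D \<Longrightarrow> g \<in> graded_piece n a E \<Longrightarrow> f * g \<in> p \<Longrightarrow> f \<in> p \<or> g \<in> p"
    and v: "i \<le> n" "a i > 0" "var i \<notin> p"
  shows "p \<in> wproj n a"
proof -
  have "primeideal p (poly_ring n)"
  proof (rule primeidealI2[OF _ cring_poly_ring])
    have um: "- f \<in> p" if "f \<in> p" for f using mult[OF that poly_ring_uminus[OF poly_ring_one]] by simp
    show "additive_subgroup p (poly_ring n)"
    proof (rule additive_subgroupI, rule group.subgroupI)
      show "Group.group (add_monoid (poly_ring n :: 'k mpol ring))"
        using cring_poly_ring[of n, where 'k = 'k] abelian_group.a_group cring.axioms(1) ring.is_abelian_group by blast
      fix f assume f: "f \<in> p"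
      have "inv\<^bsub>add_monoid (poly_ring n)\<^esub> f = - f"
        by (rule group.inv_equality[OF \<open>Group.group (add_monoid (poly_ring n :: 'k mpol ring))\<close>])
          (use f sub poly_ring_uminus in auto)
      then show "inv\<^bsub>add_monoid (poly_ring n)\<^esub> f \<in> p" using um[OF f] by simp
    qed (use sub zero add in auto)
    show "carrier (poly_ring n) \<noteq> p" using v var_carrier by blast
    show "f \<in> p \<or> g \<in> p" if "f \<in> carrier (poly_ring n)" "g \<in> carrier (poly_ring n)" "f \<otimes>\<^bsub>poly_ring n\<^esub> g \<in> p" for f g
      using homogeneous_primeI[OF sub add mult hom prime zero] that by simp
    show "x \<otimes>\<^bsub>poly_ring n\<^esub> f \<in> p" if "f \<in> p" "x \<in> carrier (poly_ring n)" for f x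
      using mult[OF that] by (simp add: mult.commute)
  qed (use mult in auto)
  moreover have "var i \<in> irrelevant_ideal n a"
    using v var_carrier[OF v(1)] by (auto simp: irrelevant_ideal_def intro!: hom_comp_eq_0)
  ultimately show ?thesis using hom v unfolding wproj_def by blast
qed

section \<open>Factorization of monomials\<close>

text \<open>Listing the variables of a monomial with repetition makes partial sums of their weights
  available for the pigeonhole argument.\<close>

lemma monomial_list: "\<exists>xs. (m :: nat \<Rightarrow>\<^sub>0 nat) = sum_list (map (\<lambda>j. Poly_Mapping.single j 1) xs)"
proof (induction "wdeg (\<lambda>_. 1) m" arbitrary: m)
  case 0
  then have "m = 0" by (auto simp: wdeg_def in_keys_iff intro: poly_mapping_eqI)
  then show ?case by (intro exI[of _ "[]"]) simp
next
  case (Suc k)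
  then have "m \<noteq> 0" by auto
  then obtain i where "i \<in> Poly_Mapping.keys m" by (metis all_not_in_conv keys_eq_empty)
  then obtain m' where m': "m = Poly_Mapping.single i 1 + m'" by (rule single_eq_mult_var)
  with Suc.hyps(2) have "k = wdeg (\<lambda>_. 1) m'" by (simp add: wdeg_add)
  then obtain xs where "m' = sum_list (map (\<lambda>j. Poly_Mapping.single j 1) xs)" using Suc.hyps(1) by blast
  then show ?case using m' by (intro exI[of _ "i # xs"]) simp
qed

lemma wdeg_sum_list: "wdeg a (sum_list (map (\<lambda>j. Poly_Mapping.single j 1) xs)) = sum_list (map a xs)"
  by (induction xs) (auto simp: wdeg_add)

lemma keys_sum_list: "Poly_Mapping.keys (sum_list (map (\<lambda>j. Poly_Mapping.single j 1) xs) :: nat \<Rightarrow>\<^sub>0 nat) = set xs"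
  by (induction xs) (auto simp: keys_add_nat)

text \<open>Two of the \<open>c + 1\<close> first partial sums agree modulo \<open>c\<close>.\<close>

lemma zero_sum_segment:
  fixes f :: "'a \<Rightarrow> nat"
  assumes "c > 0" "length xs \<ge> c"
  obtains us vs ws where "xs = us @ vs @ ws" "vs \<noteq> []" "length vs \<le> c" "c dvd sum_list (map f vs)"
proof -
  let ?g = "\<lambda>k. sum_list (map f (take k xs)) mod c"
  have "\<not> inj_on ?g {..c}"
  proof (rule pigeonhole)
    have "?g ` {..c} \<subseteq> {..<c}" using assms(1) by auto
    then have "card (?g ` {..c}) \<le> c" using card_mono[of "{..<c}"] by fastforce
    then show "card (?g ` {..c}) < card {..c}" by simp
  qed
  then obtain k l where kl: "k < l" "l \<le> c" "?g k = ?g l"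
    unfolding inj_on_def by (metis atMost_iff linorder_neqE_nat)
  have t: "take l xs = take k xs @ take (l - k) (drop k xs)"
    using kl(1) by (metis le_add_diff_inverse less_imp_le take_add)
  have "(sum_list (map f (take k xs)) + sum_list (map f (take (l - k) (drop k xs)))) mod c = ?g k"
    using kl(3) unfolding t by simp
  then have "c dvd sum_list (map f (take (l - k) (drop k xs)))"
    using mod_eq_dvd_iff_nat by fastforce
  moreover have "xs = take k xs @ take (l - k) (drop k xs) @ drop l xs"
    by (metis append_assoc append_take_drop_id t)
  moreover have "take (l - k) (drop k xs) \<noteq> []" "length (take (l - k) (drop k xs)) \<le> c"
    using kl assms(2) by auto
  ultimately show ?thesis using that by blast
qed

section \<open>Substitution of monomials for the variables\<close>

definition mexp :: "(nat \<Rightarrow> (nat \<Rightarrow>\<^sub>0 nat)) \<Rightarrow> (nat \<Rightarrow>\<^sub>0 nat) \<Rightarrow> (nat \<Rightarrow>\<^sub>0 nat)" where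
  "mexp expo m = (\<Sum>j\<in>Poly_Mapping.keys m. of_nat (Poly_Mapping.lookup m j) * expo j)"

text \<open>The ring homomorphism that replaces \<open>y_j\<close> by the monomial with exponent
  \<open>expo j\<close>. Points of Proj will be contracted along it.\<close>

definition msubst :: "(nat \<Rightarrow> (nat \<Rightarrow>\<^sub>0 nat)) \<Rightarrow> 'k::field mpol \<Rightarrow> 'k mpol" where
  "msubst expo F = (\<Sum>m\<in>Poly_Mapping.keys F. Poly_Mapping.single (mexp expo m) (Poly_Mapping.lookup F m))"

lemma mexp_superset:
  "finite A \<Longrightarrow> Poly_Mapping.keys m \<subseteq> A \<Longrightarrow> mexp expo m = (\<Sum>j\<in>A. of_nat (Poly_Mapping.lookup m j) * expo j)"
  unfolding mexp_def by (rule sum.mono_neutral_left) (auto simp: in_keys_iff)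

lemma mexp_add: "mexp expo (m + m') = mexp expo m + mexp expo m'"
proof -
  let ?A = "Poly_Mapping.keys m \<union> Poly_Mapping.keys m'"
  have "mexp expo x = (\<Sum>j\<in>?A. of_nat (Poly_Mapping.lookup x j) * expo j)" if "x \<in> {m, m', m + m'}" for x
    using that by (intro mexp_superset) (auto simp: keys_add_nat)
  then show ?thesis by (simp add: lookup_add algebra_simps sum.distrib)
qed

lemma mexp_zero [simp]: "mexp expo 0 = 0"
  by (simp add: mexp_def)

lemma mexp_single: "mexp expo (Poly_Mapping.single j k) = of_nat k * expo j"
  by (cases "k = 0") (auto simp: mexp_def)

lemma mexp_sum: "mexp expo (sum f A) = (\<Sum>i\<in>A. mexp expo (f i))"
  by (induction A rule: infinite_finite_induct) (auto simp: mexp_add)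

lemma mexp_of_nat_mult: "mexp expo (of_nat k * m) = of_nat k * mexp expo m"
  by (induction k) (auto simp: mexp_add algebra_simps)

text \<open>Terms of a sum of polynomials may cancel; over a common larger index set additivity
  becomes a termwise identity.\<close>

lemma msubst_superset:
  "finite A \<Longrightarrow> Poly_Mapping.keys F \<subseteq> A \<Longrightarrow>
   msubst expo F = (\<Sum>m\<in>A. Poly_Mapping.single (mexp expo m) (Poly_Mapping.lookup F m))"
  unfolding msubst_def by (rule sum.mono_neutral_left) (auto simp: in_keys_iff)

lemma msubst_add: "msubst expo (F + G) = msubst expo F + msubst expo G"
proof -
  let ?A = "Poly_Mapping.keys F \<union> Poly_Mapping.keys G"
  have "msubst expo x = (\<Sum>m\<in>?A. Poly_Mapping.single (mexp expo m) (Poly_Mapping.lookup x m))" if "x \<in> {F, G, F + G}" for x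
    using that Poly_Mapping.keys_add[of F G] by (intro msubst_superset) auto
  then show ?thesis by (simp add: lookup_add single_add sum.distrib)
qed

lemma msubst_zero [simp]: "msubst expo 0 = 0"
  by (simp add: msubst_def)

lemma msubst_single: "msubst expo (Poly_Mapping.single m c) = Poly_Mapping.single (mexp expo m) c"
  by (cases "c = 0") (auto simp: msubst_def)

lemma msubst_one [simp]: "msubst expo 1 = 1"
  using msubst_single[of expo 0 1] by simp

lemma msubst_sum: "msubst expo (sum f A) = (\<Sum>i\<in>A. msubst expo (f i))"
  by (induction A rule: infinite_finite_induct) (auto simp: msubst_add)

lemma msubst_mult: "msubst expo (F * G) = msubst expo F * msubst expo G"
proof -
  have "msubst expo (F * G) =
      msubst expo ((\<Sum>m\<in>Poly_Mapping.keys F. Poly_Mapping.single m (Poly_Mapping.lookup F m)) *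
                  (\<Sum>m\<in>Poly_Mapping.keys G. Poly_Mapping.single m (Poly_Mapping.lookup G m)))"
    by (simp only: poly_mapping_single_sum[symmetric])
  also have "\<dots> = msubst expo F * msubst expo G"
    by (simp add: sum_product msubst_sum mult_single msubst_single mexp_add msubst_def[of _ F] msubst_def[of _ G])
  finally show ?thesis .
qed

lemma msubst_diff: "msubst expo (F - G) = msubst expo F - msubst expo G"
  by (metis add_diff_cancel_right' diff_add_cancel msubst_add)

lemma msubst_power: "msubst expo (F ^ k) = msubst expo F ^ k"
  by (induction k) (auto simp: msubst_mult)

lemma Fract_one_add: "Fraction_Field.Fract (x + y) 1 = Fraction_Field.Fract x 1 + Fraction_Field.Fract y 1"
  by simp

lemma Fract_one_mult: "Fraction_Field.Fract (x * y) 1 = Fraction_Field.Fract x 1 * Fraction_Field.Fract y 1"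
  by simp

lemma Fract_one_sum: "Fraction_Field.Fract (sum f A) 1 = (\<Sum>i\<in>A. Fraction_Field.Fract (f i) 1)"
  by (induction A rule: infinite_finite_induct) (auto simp: Fract_one_add Zero_fract_def simp del: add_fract)

lemma Fract_one_prod: "Fraction_Field.Fract (prod f A) 1 = (\<Prod>i\<in>A. Fraction_Field.Fract (f i) 1)"
  by (induction A rule: infinite_finite_induct) (auto simp: Fract_one_mult One_fract_def simp del: mult_fract)

lemma Fract_one_power: "Fraction_Field.Fract (x ^ k) 1 = Fraction_Field.Fract x 1 ^ k"
  by (induction k) (auto simp: Fract_one_mult One_fract_def simp del: mult_fract)

lemma prod_single: "(\<Prod>i\<in>A. Poly_Mapping.single (f i) 1) = (Poly_Mapping.single (sum f A) 1 :: 'k::field mpol)"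
  by (induction A rule: infinite_finite_induct) (auto simp: mult_single)

text \<open>For sections that are monomials, evaluation in the field of fractions is the
  substitution homomorphism, so the morphism can be studied with polynomials only.\<close>

lemma eval_fract_monomials:
  "eval_fract (\<lambda>j. Fraction_Field.Fract (Poly_Mapping.single (expo j) 1) 1) F = Fraction_Field.Fract (msubst expo F) 1"
proof -
  have "Fraction_Field.Fract (Poly_Mapping.single 0 c) 1 *
      (\<Prod>j\<in>Poly_Mapping.keys m. Fraction_Field.Fract (Poly_Mapping.single (expo j) 1) 1 ^ Poly_Mapping.lookup m j) =
    Fraction_Field.Fract (Poly_Mapping.single (mexp expo m) c) 1" for c :: 'a and m
    by (simp add: Fract_one_power[symmetric] Fract_one_prod[symmetric] single_power prod_single mult_single mexp_def)
  then show ?thesis by (simp add: eval_fract_def msubst_def Fract_one_sum)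
qed

text \<open>\<open>expo\<close> enumerates all monomials of degree \<open>d\<close>, possibly with
  repetitions. The last two conditions also cover indices beyond \<open>N\<close>, so that every
  substitution result is a polynomial in \<open>x_0, ..., x_n\<close> with degrees multiplied by
  \<open>d\<close>.\<close>

locale monomial_embedding =
  fixes n :: nat and a :: "nat \<Rightarrow> nat" and d N :: nat and expo :: "nat \<Rightarrow> (nat \<Rightarrow>\<^sub>0 nat)"
  assumes pos: "i \<le> n \<Longrightarrow> a i > 0"
    and d_pos: "d > 0"
    and weight_dvd: "i \<le> n \<Longrightarrow> a i dvd d"
    and weight_mult_le: "i \<le> n \<Longrightarrow> j \<le> n \<Longrightarrow> a i \<noteq> a j \<Longrightarrow> a i * a j \<le> d"
    and expo_image: "expo ` {..N} = {m. Poly_Mapping.keys m \<subseteq> {..n} \<and> wdeg a m = d}"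
    and expo_deg: "wdeg a (expo j) = d"
    and expo_keys: "Poly_Mapping.keys (expo j) \<subseteq> {..n}"
begin

lemma obtain_expo:
  assumes "Poly_Mapping.keys m \<subseteq> {..n}" "wdeg a m = d"
  obtains j where "j \<le> N" "expo j = m"
proof -
  from assms have "m \<in> expo ` {..N}" unfolding expo_image by blast
  then show ?thesis using that by auto
qed

text \<open>The induction step for lifting monomials: as \<open>a i\<close> divides both
  \<open>d\<close> and the degree of \<open>m1\<close>, a power of \<open>x_i\<close> fills
  \<open>m1\<close> up to degree \<open>d\<close>.\<close>

lemma split_monomial:
  assumes i: "i \<le> n" and m: "Poly_Mapping.keys m \<subseteq> {..n}" "a i dvd wdeg a m" "wdeg a m > 0"
  obtains m1 m2 where "m = m1 + m2" "a i dvd wdeg a m1" "0 < wdeg a m1" "wdeg a m1 \<le> d"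
proof (cases "\<exists>j\<in>Poly_Mapping.keys m. a j = a i")
  case True
  then obtain j where j: "j \<in> Poly_Mapping.keys m" "a j = a i" by blast
  then obtain m' where "m = Poly_Mapping.single j 1 + m'" using single_eq_mult_var by blast
  then show ?thesis
    using that[of "Poly_Mapping.single j 1" m'] j m i pos[of i] weight_dvd[of i] d_pos
    by (auto intro: dvd_imp_le)
next
  case False
  let ?L = "\<lambda>xs. sum_list (map (\<lambda>j. Poly_Mapping.single j 1) xs) :: nat \<Rightarrow>\<^sub>0 nat"
  obtain xs where xs: "m = ?L xs" using monomial_list by blast
  have km: "Poly_Mapping.keys m = set xs" by (simp only: xs keys_sum_list)
  \<comment> \<open>In this case every variable of \<open>m\<close> has a weight different from
    \<open>a i\<close>, hence at most \<open>d / a i\<close>.\<close>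
  have le: "a i * wdeg a (?L ys) \<le> length ys * d" if "set ys \<subseteq> set xs" for ys
    using that
  proof (induction ys)
    case (Cons y ys)
    then have "y \<in> Poly_Mapping.keys m" using km by simp
    then have "a i * a y \<le> d" using m(1) False i by (intro weight_mult_le) auto
    then show ?case using Cons by (auto simp: wdeg_add algebra_simps)
  qed simp
  have short: "wdeg a (?L ys) \<le> d" if "set ys \<subseteq> set xs" "length ys \<le> a i" for ys
  proof -
    have "a i * wdeg a (?L ys) \<le> a i * d"
      using le[OF that(1)] that(2) by (meson le_trans mult_le_mono1)
    then show ?thesis using pos[OF i] by simp
  qed
  show ?thesis
  proof (cases "length xs \<le> a i")
    case True
    then show ?thesis using that[of m 0] m short[of xs] xs by auto
  next
    \<comment> \<open>A long list contains a segment of at most \<open>a i\<close> variables with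
      weight sum divisible by \<open>a i\<close>. That it is nonempty makes the degree of the factor
      positive.\<close>
    case False
    then obtain us vs ws where v: "xs = us @ vs @ ws" "vs \<noteq> []" "length vs \<le> a i" "a i dvd sum_list (map a vs)"
      using zero_sum_segment[of "a i" xs a] pos[OF i] by auto
    show ?thesis
    proof (rule that)
      show "m = ?L vs + ?L (us @ ws)" by (simp add: xs v(1) algebra_simps)
      show "a i dvd wdeg a (?L vs)" using v(4) by (simp only: wdeg_sum_list)
      obtain y ys where y: "vs = y # ys" using v(2) by (cases vs) auto
      then have "y \<in> Poly_Mapping.keys m" using km v(1) by simp
      then have "a y > 0" using m(1) pos by auto
      then show "0 < wdeg a (?L vs)" by (simp add: y wdeg_add)
      show "wdeg a (?L vs) \<le> d" using v by (intro short) auto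
    qed
  qed
qed

text \<open>The exponent \<open>r\<close> makes \<open>m x\<^sub>i\<^sup>r\<close> of degree \<open>d wdeg(m)\<close>, the degree of
  a product of \<open>wdeg(m)\<close> monomials of degree \<open>d\<close>.\<close>

lemma monomial_lift:
  assumes i: "i \<le> n"
  shows "Poly_Mapping.keys m \<subseteq> {..n} \<Longrightarrow> a i dvd wdeg a m \<Longrightarrow> a i * r + wdeg a m = wdeg a m * d \<Longrightarrow>
    \<exists>Y. Poly_Mapping.keys Y \<subseteq> {..N} \<and> wdeg (\<lambda>_. 1) Y = wdeg a m \<and> mexp expo Y = m + Poly_Mapping.single i r"
proof (induction "wdeg a m" arbitrary: m r rule: less_induct)
  case less
  show ?case
  proof (cases "wdeg a m = 0")
    case True
    then have "m = 0" using wdeg_eq_0[of a m n] less.prems pos by auto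
    then show ?thesis using less.prems True pos[OF i] by (intro exI[of _ 0]) auto
  next
    case False
    then obtain m1 m2 where m: "m = m1 + m2" "a i dvd wdeg a m1" "0 < wdeg a m1" "wdeg a m1 \<le> d"
      using split_monomial[OF i less.prems(1,2)] by auto
    have dvd2: "a i dvd wdeg a m2" using less.prems(2) m by (simp add: wdeg_add dvd_add_right_iff)
    obtain e where e: "d = a i * e" using weight_dvd[OF i] by blast
    obtain u where u: "wdeg a m1 = a i * u" using m(2) by blast
    obtain v where v: "wdeg a m2 = a i * v" using dvd2 by blast
    have ai: "a i > 0" using pos[OF i] .
    have u0: "u > 0" using m(3) u by auto
    have ue: "u \<le> e" using m(4) u e ai by simp
    \<comment> \<open>One generator carries \<open>m1\<close>; \<open>w\<close> further copies of
      the pure power \<open>x_i^e\<close> raise the number of generators used up to the degree of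
      \<open>m1\<close>.\<close>
    define w where "w = a i * u - 1"
    have w: "a i * u = Suc w" using u0 ai by (simp add: w_def)
    have d1: "d \<ge> 1" using d_pos by simp
    have "a i * (v * (d - 1)) + wdeg a m2 = wdeg a m2 * d"
      using d1 by (cases d) (auto simp: v algebra_simps)
    then obtain Y2 where Y2: "Poly_Mapping.keys Y2 \<subseteq> {..N}" "wdeg (\<lambda>_. 1) Y2 = wdeg a m2"
        "mexp expo Y2 = m2 + Poly_Mapping.single i (v * (d - 1))"
      using less.hyps[of m2 "v * (d - 1)"] m dvd2 less.prems(1) by (auto simp: wdeg_add keys_add_nat)
    have deg: "wdeg a (m1 + Poly_Mapping.single i (e - u)) = d"
      using ue by (simp add: wdeg_add u e flip: distrib_left)
    obtain j where j: "j \<le> N" "expo j = m1 + Poly_Mapping.single i (e - u)"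
    proof (rule obtain_expo)
      show "Poly_Mapping.keys (m1 + Poly_Mapping.single i (e - u)) \<subseteq> {..n}"
        using less.prems(1) m(1) i by (auto simp: keys_add_nat)
    qed (use deg in auto)
    obtain j0 where j0: "j0 \<le> N" "expo j0 = Poly_Mapping.single i e"
      by (rule obtain_expo[of "Poly_Mapping.single i e"]) (use i e in auto)
    define Y where "Y = Poly_Mapping.single j 1 + Poly_Mapping.single j0 w + Y2"
    have "a i * r + a i * (u + v) = a i * ((u + v) * d)"
      using less.prems(3) by (simp add: m(1) wdeg_add u v algebra_simps)
    then have "a i * (r + (u + v)) = a i * ((u + v) * d)" by (simp only: distrib_left)
    then have r: "r + (u + v) = (u + v) * d" using ai by simp
    \<comment> \<open>This compares exponents of \<open>x_i\<close>. Adding \<open>u + v\<close> on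
      both sides absorbs the truncated subtractions in \<open>e - u\<close> and
      \<open>d - 1\<close>.\<close>
    have "r + u + v = (e - u) + w * e + v * (d - 1) + u + v"
    proof -
      have "u * d = Suc w * e" by (simp add: e flip: w)
      then have "(e - u) + w * e + u = u * d" using ue by simp
      moreover have "v * (d - 1) + v = v * d" using d1 by (cases d) auto
      ultimately show ?thesis using r by (simp add: algebra_simps)
    qed
    then have "r = (e - u) + w * e + v * (d - 1)" by simp
    then have "mexp expo Y = m + Poly_Mapping.single i r"
      by (simp add: Y_def mexp_add mexp_single j j0 Y2 of_nat_mult_single m(1) single_add algebra_simps)
    moreover have "wdeg (\<lambda>_. 1) Y = wdeg a m"
      using w Y2(2) by (simp add: Y_def wdeg_add m(1) u)
    moreover have "Poly_Mapping.keys Y \<subseteq> {..N}"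
      using Y2 j j0 by (auto simp: Y_def keys_add_nat)
    ultimately show ?thesis by blast
  qed
qed

text \<open>Lift term by term with \<open>monomial_lift\<close>: the exponent \<open>r\<close>
  depends on the degree only, so one power of \<open>x_i\<close> serves all terms.\<close>

lemma lift_graded:
  assumes i: "i \<le> n" and f: "f \<in> graded_piece n a (int D)" and D: "a i dvd D" "a i * r + D = D * d"
  obtains F where "F \<in> graded_piece N (\<lambda>_. 1) (int D)" "msubst expo F = f * var i ^ r"
proof -
  have "\<exists>Y. Poly_Mapping.keys Y \<subseteq> {..N} \<and> wdeg (\<lambda>_. 1) Y = D \<and> mexp expo Y = m + Poly_Mapping.single i r"
    if "m \<in> Poly_Mapping.keys f" for m
    using monomial_lift[OF i, of m r] that f D by (auto simp: graded_piece_iff carrier_poly_ring_iff)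
  then obtain Y where Y: "\<And>m. m \<in> Poly_Mapping.keys f \<Longrightarrow> Poly_Mapping.keys (Y m) \<subseteq> {..N} \<and>
      wdeg (\<lambda>_. 1) (Y m) = D \<and> mexp expo (Y m) = m + Poly_Mapping.single i r" by metis
  show ?thesis
  proof
    show "(\<Sum>m\<in>Poly_Mapping.keys f. Poly_Mapping.single (Y m) (Poly_Mapping.lookup f m)) \<in> graded_piece N (\<lambda>_. 1) (int D)"
      using Y by (intro graded_piece_sum graded_piece_single) auto
    have "f * var i ^ r = (\<Sum>m\<in>Poly_Mapping.keys f. Poly_Mapping.single m (Poly_Mapping.lookup f m)) * var i ^ r"
      by (simp only: poly_mapping_single_sum[symmetric])
    also have "\<dots> = (\<Sum>m\<in>Poly_Mapping.keys f. Poly_Mapping.single (m + Poly_Mapping.single i r) (Poly_Mapping.lookup f m))"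
      unfolding var_power by (simp add: sum_distrib_right mult_single)
    finally show "msubst expo (\<Sum>m\<in>Poly_Mapping.keys f. Poly_Mapping.single (Y m) (Poly_Mapping.lookup f m)) = f * var i ^ r"
      using Y by (simp add: msubst_sum msubst_single)
  qed
qed

end

section \<open>The morphism given by all monomials of a fixed degree\<close>

context monomial_embedding
begin

abbreviation subst :: "'k::field mpol \<Rightarrow> 'k mpol" where
  "subst \<equiv> msubst expo"

lemma keys_mexp: "Poly_Mapping.keys (mexp expo m) \<subseteq> {..n}"
proof -
  have "Poly_Mapping.keys (of_nat k * expo j) \<subseteq> {..n}" for k j
    by (induction k) (use expo_keys[of j] in \<open>auto simp: keys_add_nat algebra_simps\<close>)
  then show ?thesis unfolding mexp_def
    using keys_sum[of "\<lambda>j. of_nat (Poly_Mapping.lookup m j) * expo j" "Poly_Mapping.keys m"] by blast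
qed

lemma wdeg_mexp: "wdeg a (mexp expo m) = d * wdeg (\<lambda>_. 1) m"
proof -
  have "wdeg a (mexp expo m) = (\<Sum>j\<in>Poly_Mapping.keys m. Poly_Mapping.lookup m j * d)"
    by (simp add: mexp_def wdeg_sum wdeg_of_nat_mult expo_deg)
  then show ?thesis by (simp add: wdeg_def sum_distrib_left mult.commute)
qed

lemma subst_carrier: "subst F \<in> carrier (poly_ring n)"
  unfolding msubst_def by (intro poly_ring_sum poly_ring_single keys_mexp)

lemma subst_graded: "F \<in> graded_piece N' (\<lambda>_. 1) e \<Longrightarrow> subst F \<in> graded_piece n a (int d * e)"
  unfolding msubst_def
  by (intro graded_piece_sum graded_piece_single keys_mexp) (auto simp: wdeg_mexp graded_piece_iff)

text \<open>Substitution multiplies degrees by \<open>d\<close>, and \<open>d > 0\<close> makes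
  \<open>e\<close> recoverable from \<open>d * e\<close>; so components go to components and no
  other degrees occur.\<close>

lemma hom_comp_subst:
  assumes "F \<in> carrier (poly_ring N)"
  shows "hom_comp a (int d * e) (subst F) = subst (hom_comp (\<lambda>_. 1) e F)"
    and "\<not> int d dvd D \<Longrightarrow> hom_comp a D (subst F) = 0"
proof -
  let ?I = "(\<lambda>m. int (wdeg (\<lambda>_. 1) m)) ` Poly_Mapping.keys F"
  have sum: "subst F = (\<Sum>i\<in>?I. subst (hom_comp (\<lambda>_. 1) i F))"
    by (simp add: msubst_sum[symmetric] sum_hom_comp)
  have gr: "subst (hom_comp (\<lambda>_. 1) i F) \<in> graded_piece n a (int d * i)" for i
    by (rule subst_graded[OF hom_comp_graded[OF assms]])
  have "hom_comp a (int d * e) (subst F) = (\<Sum>i\<in>?I. if i = e then subst (hom_comp (\<lambda>_. 1) e F) else 0)"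
    unfolding sum hom_comp_sum
  proof (rule sum.cong[OF refl])
    fix i
    show "hom_comp a (int d * e) (subst (hom_comp (\<lambda>_. 1) i F)) = (if i = e then subst (hom_comp (\<lambda>_. 1) e F) else 0)"
      using hom_comp_of_graded[OF gr[of i], of "int d * e"] d_pos by auto
  qed
  also have "\<dots> = subst (hom_comp (\<lambda>_. 1) e F)"
  proof -
    have "hom_comp (\<lambda>_. 1) e F = 0" if "e \<notin> ?I" using that by (intro hom_comp_eq_0) force
    then show ?thesis by (auto simp: sum.delta)
  qed
  finally show "hom_comp a (int d * e) (subst F) = subst (hom_comp (\<lambda>_. 1) e F)" .
  show "\<not> int d dvd D \<Longrightarrow> hom_comp a D (subst F) = 0"
    unfolding sum hom_comp_sum hom_comp_of_graded[OF gr] by (intro sum.neutral) auto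
qed

lemma subst_var: "subst (var j) = Poly_Mapping.single (expo j) 1"
  by (simp add: msubst_single mexp_single)

text \<open>The coordinate belonging to the pure power of \<open>x_i\<close> is the one that does
  not vanish on the chart \<open>x_i \<noteq> 0\<close>.\<close>

lemma expo_power_index:
  assumes "i \<le> n"
  obtains j where "j \<le> N" "expo j = Poly_Mapping.single i (d div a i)"
  by (rule obtain_expo[of "Poly_Mapping.single i (d div a i)"]) (use assms weight_dvd[OF assms] in auto)

section \<open>Contraction of points along the substitution\<close>

definition pull :: "'k::field mpol set \<Rightarrow> 'k mpol set" where
  "pull p = {F \<in> carrier (poly_ring N). subst F \<in> p}"

lemma pull_in_wproj:
  assumes p: "p \<in> wproj n a"
  shows "pull p \<in> wproj N (\<lambda>_. 1)"
proof -
  obtain i where i: "i \<le> n" "var i \<notin> p" by (rule wproj_var[OF p])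
  obtain j where j: "j \<le> N" "expo j = Poly_Mapping.single i (d div a i)" by (rule expo_power_index[OF i(1)])
  show ?thesis
  proof (rule wprojI)
    show "0 \<in> pull p" by (simp add: pull_def poly_ring_zero zero_mem_wproj[OF p])
    show "f + g \<in> pull p" if "f \<in> pull p" "g \<in> pull p" for f g
      using that wproj_add[OF p] by (auto simp: pull_def poly_ring_add msubst_add)
    show "f * g \<in> pull p" if "f \<in> pull p" "g \<in> carrier (poly_ring N)" for f g
      using that wproj_mult[OF p _ subst_carrier] by (auto simp: pull_def poly_ring_mult msubst_mult)
    show "hom_comp (\<lambda>_. 1) D f \<in> pull p" if "f \<in> pull p" for f D
      using that wproj_hom_comp[OF p, of "subst f" "int d * D"]
      by (auto simp: pull_def hom_comp_carrier hom_comp_subst)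
    show "f \<in> pull p \<or> g \<in> pull p"
      if "f \<in> graded_piece N (\<lambda>_. 1) D" "g \<in> graded_piece N (\<lambda>_. 1) E" "f * g \<in> pull p" for f g D E
      using that wproj_prime[OF p subst_carrier subst_carrier]
      by (auto simp: pull_def msubst_mult graded_piece_carrier)
    have "var i ^ (d div a i) \<notin> p" using wproj_power[OF p var_carrier[OF i(1)]] i(2) by blast
    then show "var j \<notin> pull p" unfolding pull_def mem_Collect_eq subst_var j(2) var_power by blast
  qed (auto simp: pull_def j)
qed

text \<open>Recovers \<open>p\<close> from \<open>pull p\<close>, which gives injectivity and the
  equations of closed images. If the condition holds, it applies to a multiple of \<open>f\<close>
  in the image of the substitution, namely \<open>f ^ a i\<close> times a power of an
  \<open>x_i\<close> outside \<open>p\<close>; then primality yields \<open>f\<close>.\<close>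

lemma graded_mem_iff:
  assumes p: "p \<in> wproj n a" and f: "f \<in> graded_piece n a D"
  shows "f \<in> p \<longleftrightarrow> (\<forall>F\<in>carrier (poly_ring N). \<forall>h\<in>carrier (poly_ring n). subst F = f * h \<longrightarrow> F \<in> pull p)"
proof
  assume "f \<in> p" then show "\<forall>F\<in>carrier (poly_ring N). \<forall>h\<in>carrier (poly_ring n). subst F = f * h \<longrightarrow> F \<in> pull p"
    using wproj_mult[OF p] by (auto simp: pull_def)
next
  assume *: "\<forall>F\<in>carrier (poly_ring N). \<forall>h\<in>carrier (poly_ring n). subst F = f * h \<longrightarrow> F \<in> pull p"
  note fc = graded_piece_carrier[OF f]
  obtain i where i: "i \<le> n" "var i \<notin> p" by (rule wproj_var[OF p])
  show "f \<in> p"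
  proof (cases "D < 0")
    case True then show ?thesis using graded_piece_neg[OF f] zero_mem_wproj[OF p] by simp
  next
    case False
    define E where "E = nat D"
    have DE: "D = int E" using False by (simp add: E_def)
    \<comment> \<open>The power makes the degree divisible by \<open>a i\<close>; the exponent
      \<open>E * (d - 1)\<close> is the one that \<open>lift_graded\<close> dictates.\<close>
    have "f ^ a i \<in> graded_piece n a (int (a i * E))" using graded_piece_power[OF f] by (simp add: DE)
    moreover have "a i * (E * (d - 1)) + a i * E = a i * E * d" using d_pos by (cases d) (auto simp: algebra_simps)
    ultimately obtain F where F: "F \<in> graded_piece N (\<lambda>_. 1) (int (a i * E))" "subst F = f ^ a i * var i ^ (E * (d - 1))"
      using lift_graded[OF i(1)] by (metis dvd_triv_left)
    have "subst F = f * (f ^ (a i - 1) * var i ^ (E * (d - 1)))"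
      using pos[OF i(1)] F(2) by (simp add: power_eq_if mult.assoc)
    then have "F \<in> pull p" using * graded_piece_carrier[OF F(1)]
      by (meson poly_ring_mult poly_ring_power fc i(1) var_carrier)
    then have "f ^ a i * var i ^ (E * (d - 1)) \<in> p" by (simp add: pull_def F(2))
    then have "f ^ a i \<in> p" by (rule wproj_var_not_in[OF p i poly_ring_power[OF fc]])
    then show ?thesis by (rule wproj_power[OF p fc])
  qed
qed

text \<open>The preimage of \<open>q\<close> consists of the \<open>f\<close> all of whose homogeneous multiples lying in the image of the
  substitution come from \<open>q\<close>. As \<open>q\<close> contains the kernel, the choice of the preimage is irrelevant.\<close>

lemma pull_surj:
  fixes q :: "'k::field mpol set"
  assumes q: "q \<in> wproj N (\<lambda>_. 1)" and ker: "\<And>F. F \<in> carrier (poly_ring N) \<Longrightarrow> subst F = 0 \<Longrightarrow> F \<in> q"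
  obtains p where "p \<in> wproj n a" "pull p = q"
proof -
  have same: "F \<in> q" if "F \<in> carrier (poly_ring N)" "G \<in> q" "subst F = subst G" for F G
  proof -
    have "G \<in> carrier (poly_ring N)" using wproj_subset[OF q] that(2) by blast
    then have "F - G \<in> q" using that by (intro ker) (auto simp: msubst_diff poly_ring_diff)
    then show ?thesis using wproj_add[OF q _ that(2)] by force
  qed
  \<comment> \<open>Some coordinate of a pure power lies outside \<open>q\<close>: a power of any
    coordinate outside \<open>q\<close> has the same image as a product of such coordinates.\<close>
  have "\<exists>j i. i \<le> n \<and> j \<le> N \<and> expo j = Poly_Mapping.single i (d div a i) \<and> var j \<notin> q"
  proof -
    obtain j where j: "j \<le> N" "var j \<notin> q" by (rule wproj_var[OF q])
    obtain J where J: "\<And>i. i \<le> n \<Longrightarrow> J i \<le> N \<and> expo (J i) = Poly_Mapping.single i (d div a i)"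
    proof -
      have "\<forall>i. \<exists>j. i \<le> n \<longrightarrow> j \<le> N \<and> expo j = Poly_Mapping.single i (d div a i)"
        using expo_power_index by metis
      then show ?thesis using that by metis
    qed
    \<comment> \<open>With \<open>c_i\<close> the exponent of \<open>x_i\<close> in
      \<open>expo j\<close>, the pure power \<open>x_i^(d / a_i)\<close> raised to
      \<open>a_i * c_i\<close> is \<open>x_i^(d * c_i)\<close>. So \<open>Y\<close> has the same
      image as the \<open>d\<close>-th power of \<open>y_j\<close>.\<close>
    define Y where "Y = (\<Sum>i\<le>n. Poly_Mapping.single (J i) (a i * Poly_Mapping.lookup (expo j) i))"
    have "mexp expo Y = (\<Sum>i\<le>n. Poly_Mapping.single i (d * Poly_Mapping.lookup (expo j) i))"
      unfolding Y_def mexp_sum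
    proof (rule sum.cong[OF refl])
      fix i assume "i \<in> {..n}"
      then have i: "i \<le> n" by simp
      then have "a i * Poly_Mapping.lookup (expo j) i * (d div a i) = d * Poly_Mapping.lookup (expo j) i"
        using weight_dvd[OF i] by (metis dvd_mult_div_cancel mult.assoc mult.commute)
      then show "mexp expo (Poly_Mapping.single (J i) (a i * Poly_Mapping.lookup (expo j) i)) =
          Poly_Mapping.single i (d * Poly_Mapping.lookup (expo j) i)"
        using J[OF i] by (simp only: mexp_single of_nat_mult_single)
    qed
    also have "\<dots> = of_nat d * expo j"
    proof (rule poly_mapping_eqI)
      fix k
      have "Poly_Mapping.lookup (of_nat c * m) k = c * Poly_Mapping.lookup m k" for c and m :: "nat \<Rightarrow>\<^sub>0 nat"
        by (induction c) (auto simp: lookup_add algebra_simps)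
      then show "Poly_Mapping.lookup (\<Sum>i\<le>n. Poly_Mapping.single i (d * Poly_Mapping.lookup (expo j) i)) k =
          Poly_Mapping.lookup (of_nat d * expo j) k"
        using expo_keys[of j] not_in_keys_iff_lookup_eq_zero[of k "expo j"]
        by (auto simp: lookup_sum lookup_single when_def sum.delta')
    qed
    finally have Y: "mexp expo Y = of_nat d * expo j" .
    have kY: "Poly_Mapping.keys Y \<subseteq> J ` {..n}"
      unfolding Y_def using keys_sum[of "\<lambda>i. Poly_Mapping.single (J i) (a i * Poly_Mapping.lookup (expo j) i)" "{..n}"]
      by (fastforce split: if_splits)
    have "subst (var j ^ d) = subst (Poly_Mapping.single Y 1 :: 'k mpol)"
      by (simp add: single_power msubst_single Y mexp_of_nat_mult mexp_single)
    moreover have "var j ^ d \<notin> q" using wproj_power[OF q var_carrier[OF j(1)]] j(2) by blast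
    moreover have "(var j :: 'k mpol) ^ d \<in> carrier (poly_ring N)" by (intro poly_ring_power var_carrier j)
    ultimately have Yq: "(Poly_Mapping.single Y 1 :: 'k mpol) \<notin> q" using same by blast
    \<comment> \<open>\<open>Y\<close> is not constant, since its image has positive degree; as it
      is outside \<open>q\<close>, so is each variable dividing it.\<close>
    have "wdeg a (mexp expo Y) \<noteq> 0" unfolding Y wdeg_of_nat_mult expo_deg using d_pos by simp
    then have "Y \<noteq> 0" by auto
    then obtain j' where j': "j' \<in> Poly_Mapping.keys Y" by (metis all_not_in_conv keys_eq_empty)
    then obtain Y' where Y': "Y = Poly_Mapping.single j' 1 + Y'" by (rule single_eq_mult_var)
    have "Poly_Mapping.keys Y' \<subseteq> {..N}" using kY J unfolding Y' by (auto simp: keys_add_nat)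
    then have "var j' \<notin> q"
      using wproj_mult[OF q, of "var j'" "Poly_Mapping.single Y' 1"] Yq unfolding Y'
      by (auto simp: mult_single poly_ring_single)
    then show ?thesis using j' kY J by blast
  qed
  then obtain i j0 where i: "i \<le> n" and j0: "j0 \<le> N" "expo j0 = Poly_Mapping.single i (d div a i)" "var j0 \<notin> q"
    by blast
  define e where "e = d div a i"
  have e: "d = a i * e" using weight_dvd[OF i] by (simp add: e_def)
  have e0: "e > 0" using e d_pos by (cases e) auto
  have y: "subst (var j0 ^ k :: 'k mpol) = var i ^ (e * k)" for k
    unfolding msubst_power subst_var j0(2) e_def
    unfolding var_power
    by (simp only: single_power of_nat_mult_single power_one mult.commute)
  \<comment> \<open>Powers of \<open>x_i^e\<close> are images of powers of a coordinate outside
    \<open>q\<close>, so they may be cancelled.\<close>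
  have yq: "F \<in> q" if "F \<in> carrier (poly_ring N)" "G \<in> q" "subst G = subst F * var i ^ (e * k)" for F G k
  proof -
    have "F * var j0 ^ k \<in> q"
      using that(3) unfolding y[symmetric] msubst_mult[symmetric]
      by (intro same[OF poly_ring_mult[OF that(1) poly_ring_power[OF var_carrier[OF j0(1)]]] that(2)]) simp
    then show ?thesis by (rule wproj_var_not_in[OF q j0(1,3) that(1)])
  qed
  \<comment> \<open>The exponent \<open>k\<close> is chosen before \<open>g\<close>: two elements of
    the same degree can be lifted with the same power of \<open>x_i\<close>.\<close>
  have lift: "\<exists>k. \<forall>g :: 'k mpol \<in> graded_piece n a D. \<exists>F \<in> carrier (poly_ring N). subst F = g * var i ^ (e * k)"
    if "int d dvd D" for D
  proof (cases "D < 0")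
    case True
    then have "\<forall>g :: 'k mpol \<in> graded_piece n a D. \<exists>F \<in> carrier (poly_ring N). subst F = g * var i ^ (e * 0)"
      by (auto dest!: graded_piece_neg intro!: bexI[of _ 0] poly_ring_zero)
    then show ?thesis by blast
  next
    case False
    obtain k' where k': "D = int d * k'" using \<open>int d dvd D\<close> by blast
    define k where "k = nat k'"
    have "k' \<ge> 0" using False k' d_pos by (metis mult_pos_neg not_le of_nat_0_less_iff)
    then have k: "D = int (d * k)" using k' by (simp add: k_def)
    show ?thesis
    proof (intro exI[of _ "k * (d - 1)"] ballI)
      fix g :: "'k mpol" assume g: "g \<in> graded_piece n a D"
      have "a i * (e * (k * (d - 1))) + d * k = (a i * e) * k * (d - 1) + d * k" by simp
      also have "\<dots> = d * k * d" using d_pos by (simp flip: e) (cases d, auto simp: algebra_simps)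
      finally obtain F where "F \<in> graded_piece N (\<lambda>_. 1) (int (d * k))" "subst F = g * var i ^ (e * (k * (d - 1)))"
        using lift_graded[OF i, of g "d * k"] g k weight_dvd[OF i] by (metis dvd_mult2)
      then show "\<exists>F\<in>carrier (poly_ring N). subst F = g * var i ^ (e * (k * (d - 1)))"
        using graded_piece_carrier by blast
    qed
  qed
  \<comment> \<open>\<open>Q D\<close> is the degree \<open>D\<close> part of the ideal to be built.
    The condition on \<open>D + E\<close> allows \<open>lift\<close> to be applied to
    \<open>f * h\<close>.\<close>
  define Q where "Q D = {f \<in> graded_piece n a D. \<forall>E. \<forall>h \<in> graded_piece n a E. \<forall>F \<in> carrier (poly_ring N).
      int d dvd D + E \<longrightarrow> subst F = f * h \<longrightarrow> F \<in> q}" for D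
  define p where "p = {f \<in> carrier (poly_ring n). \<forall>D. hom_comp a D f \<in> Q D}"
  have QD: "F \<in> q" if "f \<in> Q D" "h \<in> graded_piece n a E" "F \<in> carrier (poly_ring N)" "int d dvd D + E" "subst F = f * h"
    for f h F D E using that unfolding Q_def by blast
  have Q0: "0 \<in> Q D" for D using ker by (auto simp: Q_def graded_piece_zero)
  \<comment> \<open>That \<open>(f + g) * h\<close> is in the image says nothing about
    \<open>f * h\<close> and \<open>g * h\<close>. After multiplication by a common power of
    \<open>x_i\<close> both are in it, and \<open>yq\<close> cancels that power.\<close>
  have Q_add: "f + g \<in> Q D" if fg: "f \<in> Q D" "g \<in> Q D" for f g D
    unfolding Q_def
  proof (intro CollectI conjI allI ballI impI)
    show "f + g \<in> graded_piece n a D" using that by (auto simp: Q_def graded_piece_add)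
    fix E h F
    assume h: "h \<in> graded_piece n a E" and F: "F \<in> carrier (poly_ring N)" and D: "int d dvd D + E"
      and eq: "subst F = (f + g) * h"
    obtain k where k: "\<forall>g :: 'k mpol \<in> graded_piece n a (D + E). \<exists>F \<in> carrier (poly_ring N). subst F = g * var i ^ (e * k)"
      using lift[OF D] by blast
    have hx: "h * var i ^ (e * k) \<in> graded_piece n a (E + int (a i * (e * k)))"
      by (intro graded_piece_mult h var_power_graded i) simp
    have dx: "int d dvd D + (E + int (a i * (e * k)))"
    proof -
      have "int d dvd int (a i * (e * k))" unfolding e by (simp flip: of_nat_mult mult.assoc)
      then show ?thesis using D by (simp flip: add.assoc)
    qed
    have *: "\<exists>G\<in>q. subst G = f' * (h * var i ^ (e * k))" if "f' \<in> Q D" for f'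
    proof -
      have "f' * h \<in> graded_piece n a (D + E)" using that h by (auto simp: Q_def graded_piece_mult)
      from bspec[OF k this] obtain G where G: "G \<in> carrier (poly_ring N)" "subst G = f' * h * var i ^ (e * k)" ..
      have "subst G = f' * (h * var i ^ (e * k))" by (simp only: G(2) mult.assoc)
      then show ?thesis using QD[OF that hx G(1) dx] by (intro bexI)
    qed
    obtain G where G: "G \<in> q" "subst G = f * (h * var i ^ (e * k))" using *[OF fg(1)] by blast
    obtain G' where G': "G' \<in> q" "subst G' = g * (h * var i ^ (e * k))" using *[OF fg(2)] by blast
    have "subst (G + G') = subst F * var i ^ (e * k)"
      by (simp only: msubst_add eq G G' distrib_right mult.assoc)
    then show "F \<in> q" by (rule yq[OF F wproj_add[OF q G(1) G'(1)]])
  qed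
  have Q_mult: "f * g \<in> Q (D + D')" if f: "f \<in> Q D" and g: "g \<in> graded_piece n a D'" for f g D D'
    unfolding Q_def
  proof (intro CollectI conjI allI ballI impI)
    show "f * g \<in> graded_piece n a (D + D')" using that by (auto simp: Q_def graded_piece_mult)
    fix E h F
    assume "h \<in> graded_piece n a E" "F \<in> carrier (poly_ring N)" "int d dvd D + D' + E" "subst F = f * g * h"
    moreover from this have "g * h \<in> graded_piece n a (D' + E)" using g by (simp add: graded_piece_mult)
    ultimately show "F \<in> q" using f unfolding Q_def by (simp add: mult.assoc add.assoc)
  qed
  have Q_sum: "sum f A \<in> Q D" if "\<And>i. i \<in> A \<Longrightarrow> f i \<in> Q D" for f D and A :: "int set"
    using that by (induction A rule: infinite_finite_induct) (auto intro: Q_add Q0)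
  have p_graded: "f \<in> p \<longleftrightarrow> f \<in> Q D" if "f \<in> graded_piece n a D" for f D
    using that Q0 by (auto simp: p_def hom_comp_of_graded graded_piece_carrier)
  have p: "p \<in> wproj n a"
  proof (rule wprojI)
    show "p \<subseteq> carrier (poly_ring n)" by (auto simp: p_def)
    show "0 \<in> p" using Q0 by (simp add: p_def poly_ring_zero)
    show "f + g \<in> p" if "f \<in> p" "g \<in> p" for f g
      using that Q_add by (auto simp: p_def poly_ring_add hom_comp_add)
    show "f * g \<in> p" if f: "f \<in> p" and g: "g \<in> carrier (poly_ring n)" for f g
    proof -
      have fc: "f \<in> carrier (poly_ring n)" using f by (simp add: p_def)
      have "hom_comp a D (f * g) \<in> Q D" for D
      proof -
        let ?I = "(\<lambda>m. int (wdeg a m)) ` Poly_Mapping.keys g"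
        have "hom_comp a D (f * g) = hom_comp a D (f * (\<Sum>E\<in>?I. hom_comp a E g))" by (simp only: sum_hom_comp)
        also have "\<dots> = (\<Sum>E\<in>?I. hom_comp a (D - E) f * hom_comp a E g)"
          by (simp add: sum_distrib_left hom_comp_sum hom_comp_mult_graded[OF fc hom_comp_graded[OF g]])
        also have "\<dots> \<in> Q D"
        proof (rule Q_sum)
          fix E
          have "hom_comp a (D - E) f \<in> Q (D - E)" using f by (simp add: p_def)
          then show "hom_comp a (D - E) f * hom_comp a E g \<in> Q D"
            using Q_mult[OF _ hom_comp_graded[OF g], of "hom_comp a (D - E) f" "D - E" E] by simp
        qed
        finally show ?thesis .
      qed
      then show ?thesis using fc g by (simp add: p_def poly_ring_mult)
    qed
    show "hom_comp a D f \<in> p" if "f \<in> p" for f D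
      using that p_graded[OF hom_comp_graded, of f D] by (auto simp: p_def)
    show "f \<in> p \<or> g \<in> p"
      if f: "f \<in> graded_piece n a D" and g: "g \<in> graded_piece n a D'" and fg: "f * g \<in> p" for f g D D'
    proof (rule ccontr)
      assume "\<not> (f \<in> p \<or> g \<in> p)"
      then have "f \<notin> Q D" "g \<notin> Q D'" using p_graded[OF f] p_graded[OF g] by auto
      \<comment> \<open>Multiply the witnesses for \<open>f\<close> and \<open>g\<close>: the
        product \<open>F * F'\<close> belongs to \<open>q\<close> because \<open>f * g\<close> is in
        \<open>Q\<close>, against primality of \<open>q\<close>.\<close>
      then obtain E h F E' h' F' where
        1: "h \<in> graded_piece n a E" "F \<in> carrier (poly_ring N)" "int d dvd D + E" "subst F = f * h" "F \<notin> q" and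
        2: "h' \<in> graded_piece n a E'" "F' \<in> carrier (poly_ring N)" "int d dvd D' + E'" "subst F' = g * h'" "F' \<notin> q"
        unfolding Q_def using f g by blast
      have "f * g \<in> Q (D + D')" using fg p_graded[OF graded_piece_mult[OF f g]] by simp
      moreover have "h * h' \<in> graded_piece n a (E + E')" using 1 2 by (simp add: graded_piece_mult)
      moreover have "F * F' \<in> carrier (poly_ring N)" using 1 2 by (simp add: poly_ring_mult)
      moreover have "int d dvd (D + D') + (E + E')"
        using dvd_add[OF 1(3) 2(3)] by (simp add: algebra_simps)
      moreover have "subst (F * F') = (f * g) * (h * h')"
        using 1 2 by (simp add: msubst_mult algebra_simps)
      ultimately have "F * F' \<in> q" using QD by blast
      then show False using wproj_prime[OF q 1(2) 2(2)] 1(5) 2(5) by blast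
    qed
    show "var i \<notin> p"
    proof
      assume "var i \<in> p"
      moreover have "(var i :: 'k mpol) \<in> graded_piece n a (int (a i))" using var_power_graded[OF i, of _ a 1] by simp
      ultimately have 1: "var i \<in> Q (int (a i))" using p_graded by blast
      have 2: "(var i :: 'k mpol) ^ (e - 1) \<in> graded_piece n a (int (a i * (e - 1)))" by (rule var_power_graded[OF i refl])
      have 3: "int d dvd int (a i) + int (a i * (e - 1))"
        using e0 by (cases e) (simp_all add: e algebra_simps)
      \<comment> \<open>\<open>x_i * x_i^(e - 1)\<close> is the image of \<open>var j0\<close>, so
        \<open>var i \<in> p\<close> would put \<open>var j0\<close> into \<open>q\<close>.\<close>
      have "e * 1 = Suc (e - 1)" using e0 by simp
      then have "subst (var j0) = (var i :: 'k mpol) * var i ^ (e - 1)"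
        using y[of 1] by (simp only: power_Suc power_one_right)
      then have "var j0 \<in> q" by (rule QD[OF 1 2 var_carrier[OF j0(1)] 3])
      then show False using j0 by simp
    qed
  qed (use i pos in auto)
  have "pull p = q"
  proof (intro Set.set_eqI iffI)
    fix F assume F: "F \<in> pull p"
    then have Fc: "F \<in> carrier (poly_ring N)" by (simp add: pull_def)
    have "hom_comp (\<lambda>_. 1) k F \<in> q" for k
    proof -
      have "hom_comp a (int d * k) (subst F) \<in> Q (int d * k)" using F by (simp add: pull_def p_def)
      then have "subst (hom_comp (\<lambda>_. 1) k F) \<in> Q (int d * k)" by (simp add: hom_comp_subst[OF Fc])
      \<comment> \<open>The defining condition of \<open>Q\<close> is used with the multiplier
        \<open>h = 1\<close>.\<close>
      then show ?thesis
        by (rule QD[OF _ graded_piece_one hom_comp_carrier[OF Fc]]) simp_all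
    qed
    then show "F \<in> q" using wproj_hom_comp_iff[OF q] by blast
  next
    fix F assume F: "F \<in> q"
    then have Fc: "F \<in> carrier (poly_ring N)" using wproj_subset[OF q] by blast
    have "hom_comp a D (subst F) \<in> Q D" for D
    proof (cases "int d dvd D")
      case False then show ?thesis by (simp add: hom_comp_subst[OF Fc] Q0)
    next
      case True
      then obtain k where k: "D = int d * k" by blast
      define G where "G = hom_comp (\<lambda>_. 1) k F"
      have Gq: "G \<in> q" unfolding G_def by (rule wproj_hom_comp[OF q F])
      have "subst G \<in> Q D"
        unfolding Q_def
      proof (intro CollectI conjI allI ballI impI)
        show "subst G \<in> graded_piece n a D" unfolding G_def k by (rule subst_graded[OF hom_comp_graded[OF Fc]])
        fix E h H
        assume h: "h \<in> graded_piece n a E" and H: "H \<in> carrier (poly_ring N)" "int d dvd D + E" "subst H = subst G * h"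
        \<comment> \<open>Since \<open>d\<close> divides the degree of \<open>h\<close>, some
          \<open>h * x_i^(e * l)\<close> is the image of an \<open>L\<close>; then
          \<open>G * L\<close> in \<open>q\<close> has the image of \<open>H\<close> times this
          power.\<close>
        then have "int d dvd E" using True by (simp add: dvd_add_right_iff)
        then obtain l L where L: "L \<in> carrier (poly_ring N)" "subst L = h * var i ^ (e * l)"
          using lift h by blast
        show "H \<in> q"
          by (rule yq[OF H(1) wproj_mult[OF q Gq L(1)], of l]) (simp add: msubst_mult L H)
      qed
      then show ?thesis by (simp add: k hom_comp_subst[OF Fc] G_def)
    qed
    then show "F \<in> pull p" using Fc subst_carrier by (simp add: pull_def p_def)
  qed
  with p show ?thesis using that by blast
qed

end

lemma closedin_zariski:
  "closedin (zariski n a) C \<longleftrightarrow> (\<exists>T \<subseteq> carrier (poly_ring n). C = {p \<in> wproj n a. T \<subseteq> p})"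
proof -
  have *: "C \<subseteq> wproj n a \<and> wproj n a - C = {p \<in> wproj n a. \<not> T \<subseteq> p} \<longleftrightarrow> C = {p \<in> wproj n a. T \<subseteq> p}" for T
    by (simp only: Set.set_eq_iff subset_iff[of C] Diff_iff mem_Collect_eq) meson
  show ?thesis
    unfolding closedin_def topspace_zariski openin_zariski zariski_open_def *[symmetric]
    by (rule iffI; elim conjE exE; intro exI conjI; assumption)
qed

text \<open>From \<open>h = f / g\<close> with \<open>f\<close> in \<open>p\<close> and
  \<open>g\<close> outside, primality applied to \<open>h * g = f\<close> gives
  \<open>h \<in> p\<close>; conversely the denominator 1 works.\<close>

lemma Fract_mem_vanishing_germs:
  assumes p: "p \<in> wproj n a" and h: "h \<in> graded_piece n a D"
  shows "Fraction_Field.Fract h 1 \<in> vanishing_germs n a D p \<longleftrightarrow> h \<in> p"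
proof
  assume "Fraction_Field.Fract h 1 \<in> vanishing_germs n a D p"
  then obtain f g e where fg: "Fraction_Field.Fract h 1 = Fraction_Field.Fract f g" "f \<in> p"
      "g \<in> graded_piece n a e" "g \<notin> p" unfolding vanishing_germs_def by blast
  have "g \<noteq> 0" using fg(4) zero_mem_wproj[OF p] by blast
  then have "h * g = f" using fg(1) by (simp add: eq_fract)
  then show "h \<in> p"
    using wproj_prime[OF p graded_piece_carrier[OF h] graded_piece_carrier[OF fg(3)]] fg by blast
next
  assume "h \<in> p"
  moreover have "h \<in> graded_piece n a (0 + D)" using h by simp
  ultimately show "Fraction_Field.Fract h 1 \<in> vanishing_germs n a D p"
    unfolding vanishing_germs_def using graded_piece_one[of n a] wproj_one[OF p] by blast
qed

section \<open>The monomial sections and the closed immersion\<close>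

context monomial_embedding
begin

text \<open>The value \<open>undefined\<close> outside Proj is forced by
  \<open>twist_sections\<close>, whose members are extensional functions.\<close>

definition sec :: "nat \<Rightarrow> 'k::field mpol set \<Rightarrow> 'k mpol fract" where
  "sec j p = (if p \<in> wproj n a then Fraction_Field.Fract (Poly_Mapping.single (expo j) 1) 1 else undefined)"

lemma eval_fract_sec:
  "p \<in> wproj n a \<Longrightarrow> eval_fract (\<lambda>j. sec j p) F = Fraction_Field.Fract (subst F) 1"
  by (simp add: sec_def eval_fract_monomials)

text \<open>The vanishing conditions concern the components of \<open>subst F\<close> in degrees
  \<open>d * e\<close>. All other components are zero, so together they say
  \<open>subst F \<in> p\<close>.\<close>

lemma proj_map_eq_pull:
  assumes p: "p \<in> wproj n a"
  shows "proj_map n a (int d) N sec p = pull p"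
proof -
  have "(\<forall>e. Fraction_Field.Fract (subst (hom_comp (\<lambda>_. 1) e F)) 1 \<in> vanishing_germs n a (int d * e) p) \<longleftrightarrow> subst F \<in> p"
    if F: "F \<in> carrier (poly_ring N)" for F
  proof -
    have "(\<forall>e. Fraction_Field.Fract (subst (hom_comp (\<lambda>_. 1) e F)) 1 \<in> vanishing_germs n a (int d * e) p)
      \<longleftrightarrow> (\<forall>e. hom_comp a (int d * e) (subst F) \<in> p)"
      by (simp only: Fract_mem_vanishing_germs[OF p subst_graded[OF hom_comp_graded[OF F]]] hom_comp_subst(1)[OF F])
    also have "\<dots> \<longleftrightarrow> (\<forall>D. hom_comp a D (subst F) \<in> p)"
      using hom_comp_subst(2)[OF F] zero_mem_wproj[OF p] by (metis dvdE)
    also have "\<dots> \<longleftrightarrow> subst F \<in> p" using wproj_hom_comp_iff[OF p] by blast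
    finally show ?thesis .
  qed
  then show ?thesis unfolding proj_map_def pull_def eval_fract_sec[OF p] by blast
qed

lemma sec_in_twist_sections: "sec j \<in> twist_sections n a (int d) (wproj n a :: 'k::field mpol set set)"
proof -
  have g: "(Poly_Mapping.single (expo j) 1 :: 'k mpol) \<in> graded_piece n a (0 + int d)"
    by (rule graded_piece_single) (simp_all add: expo_keys expo_deg)
  have st: "sec j p \<in> stalk n a (int d) p" if "p \<in> wproj n a" for p :: "'k mpol set"
    unfolding stalk_def sec_def if_P[OF that]
    by (intro CollectI exI conjI) (rule refl g graded_piece_one wproj_one[OF that])+
  have "sec j \<in> (\<Pi>\<^sub>E p\<in>wproj n a :: 'k mpol set set. stalk n a (int d) p)"
    by (rule PiE_I) (erule st, simp add: sec_def)
  moreover have "openin (zariski n a) (wproj n a :: 'k mpol set set)" by (metis openin_topspace topspace_zariski)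
  moreover have "\<forall>q :: 'k mpol set \<in> wproj n a. 1 \<notin> q \<and> sec j q = Fraction_Field.Fract (Poly_Mapping.single (expo j) 1) 1"
    by (auto simp: wproj_one sec_def)
  ultimately show ?thesis unfolding twist_sections_def using g graded_piece_one[of n a] by blast
qed

text \<open>On the chart \<open>x_i \<noteq> 0\<close> the pure power \<open>x\<close> of
  \<open>x_i\<close> of degree \<open>d\<close> is a generator by itself:
  \<open>t = (t / x) * x\<close>, so all other coefficients are 0.\<close>

lemma sec_generates: "generates n a (int d) N (sec :: nat \<Rightarrow> 'k::field mpol set \<Rightarrow> _)"
  unfolding generates_def
proof (intro ballI)
  fix p :: "'k mpol set" and t
  assume p: "p \<in> wproj n a" and "t \<in> stalk n a (int d) p"
  then obtain f g e where t: "t = Fraction_Field.Fract f g" "f \<in> graded_piece n a (e + int d)"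
      "g \<in> graded_piece n a e" "g \<notin> p" unfolding stalk_def by blast
  obtain i where i: "i \<le> n" "var i \<notin> p" by (rule wproj_var[OF p])
  obtain j where j: "j \<le> N" "expo j = Poly_Mapping.single i (d div a i)" by (rule expo_power_index[OF i(1)])
  define x :: "'k mpol" where "x = Poly_Mapping.single (expo j) 1"
  have x: "x \<in> graded_piece n a (int d)"
    unfolding x_def by (rule graded_piece_single) (simp_all add: expo_keys expo_deg)
  have "x = var i ^ (d div a i)" unfolding x_def var_power j(2) ..
  then have xp: "x \<notin> p" using wproj_power[OF p var_carrier[OF i(1)]] i(2) by blast
  have gx: "g * x \<notin> p" using wproj_prime[OF p] graded_piece_carrier t x xp by blast
  have x0: "x \<noteq> 0" using xp zero_mem_wproj[OF p] by blast
  define u where "u k = (if k = j then Fraction_Field.Fract f (g * x) else 0)" for k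
  have "u k \<in> stalk n a 0 p" for k
  proof (cases "k = j")
    case True
    have "g * x \<in> graded_piece n a (e + int d)" using graded_piece_mult[OF t(3) x] .
    moreover have "f \<in> graded_piece n a (e + int d + 0)" using t(2) by simp
    ultimately show ?thesis unfolding stalk_def u_def using True gx by auto
  next
    case False
    then show ?thesis unfolding stalk_def u_def Zero_fract_def
      using graded_piece_zero[of n a "0 + 0"] graded_piece_one[of n a] wproj_one[OF p] by auto
  qed
  moreover have "t = (\<Sum>k\<le>N. u k * sec k p)"
  proof -
    have "(\<Sum>k\<le>N. u k * sec k p) = (\<Sum>k\<le>N. if k = j then Fraction_Field.Fract f (g * x) * sec j p else 0)"
      by (intro sum.cong) (auto simp: u_def)
    also have "\<dots> = Fraction_Field.Fract f (g * x) * sec j p" using j(1) by simp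
    also have "\<dots> = t" using x0 p by (simp add: sec_def t(1) mult.commute[of _ x] mult_fract_cancel flip: x_def)
    finally show ?thesis by simp
  qed
  ultimately show "\<exists>u. (\<forall>j\<le>N. u j \<in> stalk n a 0 p) \<and> t = (\<Sum>j\<le>N. u j * sec j p)"
    by (intro exI[of _ u] conjI allI impI)
qed

text \<open>Extend \<open>f / g\<close> by \<open>g ^ (a i - 1)\<close> and a power of
  \<open>x_i\<close>: numerator and denominator then have the same degree divisible by
  \<open>a i\<close> and lift to polynomials in the generators.\<close>

lemma stalk_surjective:
  assumes p: "p \<in> wproj n a"
  shows "stalk n a 0 p \<subseteq> proj_map_stalk_image n a (int d) N sec p"
proof
  fix t assume "t \<in> stalk n a 0 p"
  then obtain f g e where t: "t = Fraction_Field.Fract f g" "f \<in> graded_piece n a e"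
      "g \<in> graded_piece n a e" "g \<notin> p" unfolding stalk_def by auto
  have "g \<noteq> 0" using t(4) zero_mem_wproj[OF p] by blast
  then have "e \<ge> 0" using graded_piece_neg[OF t(3)] by force
  then obtain E where e: "e = int E" by (metis nonneg_int_cases)
  obtain i where i: "i \<le> n" "var i \<notin> p" by (rule wproj_var[OF p])
  obtain c where c: "a i = Suc c" using pos[OF i(1)] by (metis Suc_pred)
  define r where "r = E * (d - 1)"
  have r: "a i * r + a i * E = a i * E * d" unfolding r_def using d_pos by (cases d) (auto simp: algebra_simps)
  have G: "g ^ a i \<in> graded_piece n a (int (a i * E))"
    using graded_piece_power[OF t(3)] by (simp add: e)
  have F: "f * g ^ c \<in> graded_piece n a (int (a i * E))"
    using graded_piece_mult[OF t(2) graded_piece_power[OF t(3)], of c] by (simp add: e c algebra_simps)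
  obtain F' where F': "F' \<in> graded_piece N (\<lambda>_. 1) (int (a i * E))" "subst F' = f * g ^ c * var i ^ r"
    using lift_graded[OF i(1) F _ r] by auto
  obtain G' where G': "G' \<in> graded_piece N (\<lambda>_. 1) (int (a i * E))" "subst G' = g ^ a i * var i ^ r"
    using lift_graded[OF i(1) G _ r] by auto
  have "g ^ a i * var i ^ r \<notin> p"
    using wproj_var_not_in[OF p i] wproj_power[OF p] t(3,4) graded_piece_carrier poly_ring_power by metis
  then have "G' \<notin> proj_map n a (int d) N sec p" unfolding proj_map_eq_pull[OF p] by (simp add: pull_def G')
  moreover have "t = eval_fract (\<lambda>j. sec j p) F' / eval_fract (\<lambda>j. sec j p) G'"
  proof -
    have "f * (g ^ a i * var i ^ r) = f * g ^ c * var i ^ r * g" by (simp only: c power_Suc mult_ac)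
    then show ?thesis unfolding eval_fract_sec[OF p] F' G' t(1) divide_fract mult_1_right mult_1_left
      using \<open>g \<noteq> 0\<close> var_power_nonzero[of i r] by (subst eq_fract) auto
  qed
  ultimately show "t \<in> proj_map_stalk_image n a (int d) N sec p"
    unfolding proj_map_stalk_image_def using F'(1) G'(1) by blast
qed

lemma pull_image_closed:
  fixes T :: "'k::field mpol set"
  assumes T: "T \<subseteq> carrier (poly_ring n)"
  shows "closedin (zariski N (\<lambda>_. 1)) (pull ` {p \<in> wproj n a. T \<subseteq> p})"
proof -
  \<comment> \<open>The kernel cuts out the image of \<open>pull\<close>. The second set expresses
    \<open>T \<subseteq> p\<close> through \<open>pull p\<close>, component by component, by
    \<open>graded_mem_iff\<close>.\<close>
  define K where "K = {F \<in> carrier (poly_ring N). subst F = 0} \<union>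
      {F \<in> carrier (poly_ring N). \<exists>f\<in>T. \<exists>D. \<exists>h\<in>carrier (poly_ring n). subst F = hom_comp a D f * h}"
  have "pull ` {p \<in> wproj n a. T \<subseteq> p} = {q \<in> wproj N (\<lambda>_. 1). K \<subseteq> q}"
  proof (intro Set.set_eqI iffI)
    fix q assume "q \<in> pull ` {p \<in> wproj n a. T \<subseteq> p}"
    then obtain p where p: "p \<in> wproj n a" "T \<subseteq> p" "q = pull p" by blast
    have "K \<subseteq> pull p"
      using zero_mem_wproj[OF p(1)] wproj_mult[OF p(1) wproj_hom_comp[OF p(1)]] p(2)
      by (auto simp: K_def pull_def)
    then show "q \<in> {q \<in> wproj N (\<lambda>_. 1). K \<subseteq> q}" using p pull_in_wproj by blast
  next
    fix q assume "q \<in> {q \<in> wproj N (\<lambda>_. 1). K \<subseteq> q}"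
    then have q: "q \<in> wproj N (\<lambda>_. 1)" and K: "K \<subseteq> q" by auto
    then obtain p where p: "p \<in> wproj n a" "pull p = q" using pull_surj[OF q] unfolding K_def by blast
    have "T \<subseteq> p"
    proof
      fix f assume f: "f \<in> T"
      have "hom_comp a D f \<in> p" for D
        using graded_mem_iff[OF p(1) hom_comp_graded] f T K p(2) unfolding K_def by blast
      then show "f \<in> p" using wproj_hom_comp_iff[OF p(1)] by blast
    qed
    then show "q \<in> pull ` {p \<in> wproj n a. T \<subseteq> p}" using p by blast
  qed
  moreover have "K \<subseteq> carrier (poly_ring N)" by (auto simp: K_def)
  ultimately show ?thesis unfolding closedin_zariski by (intro exI[of _ K] conjI)
qed

lemma pull_inj:
  assumes p: "p \<in> wproj n a" and q: "q \<in> wproj n a" and "pull p = pull q"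
  shows "p = q"
proof -
  have "hom_comp a D f \<in> p \<longleftrightarrow> hom_comp a D f \<in> q" if "f \<in> carrier (poly_ring n)" for f D
    using graded_mem_iff[OF p hom_comp_graded[OF that]] graded_mem_iff[OF q hom_comp_graded[OF that]] assms(3) by simp
  then have "f \<in> p \<longleftrightarrow> f \<in> q" if "f \<in> carrier (poly_ring n)" for f
    using that wproj_hom_comp_iff[OF p] wproj_hom_comp_iff[OF q] by blast
  then show ?thesis using wproj_subset[OF p] wproj_subset[OF q] by blast
qed

lemma closed_immersion_sec: "closed_immersion n a (int d) N (sec :: nat \<Rightarrow> 'k::field mpol set \<Rightarrow> _)"
proof -
  let ?X = "zariski n a :: 'k mpol set topology" and ?Y = "zariski N (\<lambda>_. 1) :: 'k mpol set topology"
  let ?f = "proj_map n a (int d) N (sec :: nat \<Rightarrow> 'k mpol set \<Rightarrow> _)"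
  have "continuous_map ?X ?Y ?f"
    unfolding continuous_map_closedin topspace_zariski
  proof (intro conjI allI impI)
    show "?f \<in> wproj n a \<rightarrow> wproj N (\<lambda>_. 1)" by (intro funcsetI) (simp only: proj_map_eq_pull pull_in_wproj)
    fix C assume "closedin ?Y C"
    then obtain T where T: "T \<subseteq> carrier (poly_ring N)" "C = {q \<in> wproj N (\<lambda>_. 1). T \<subseteq> q}"
      unfolding closedin_zariski by blast
    have "?f p \<in> C \<longleftrightarrow> subst ` T \<subseteq> p" if "p \<in> wproj n a" for p
      unfolding proj_map_eq_pull[OF that] T(2) mem_Collect_eq
      using pull_in_wproj[OF that] T(1) unfolding pull_def by blast
    then have "{p \<in> wproj n a. ?f p \<in> C} = {p \<in> wproj n a. subst ` T \<subseteq> p}" by blast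
    then show "closedin ?X {p \<in> wproj n a. ?f p \<in> C}"
      unfolding closedin_zariski by (intro exI[of _ "subst ` T"] conjI image_subsetI subst_carrier)
  qed
  moreover have cl: "closed_map ?X ?Y ?f"
    unfolding closed_map_def
  proof (intro allI impI)
    fix C assume "closedin ?X C"
    then obtain T where T: "T \<subseteq> carrier (poly_ring n)" "C = {p \<in> wproj n a. T \<subseteq> p}"
      unfolding closedin_zariski by blast
    have "?f ` C = pull ` C" using T by (intro image_cong) (auto simp: proj_map_eq_pull)
    then show "closedin ?Y (?f ` C)" using pull_image_closed[OF T(1)] T(2) by simp
  qed
  moreover have "inj_on ?f (topspace ?X)"
    by (rule inj_onI) (simp only: topspace_zariski proj_map_eq_pull pull_inj)
  ultimately have "embedding_map ?X ?Y ?f" by (rule injective_closed_imp_embedding_map)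
  moreover have "closedin ?Y (?f ` wproj n a)"
    using cl unfolding closed_map_def by (metis closedin_topspace topspace_zariski)
  ultimately show ?thesis unfolding closed_immersion_def using stalk_surjective by blast
qed

lemma very_ample_degree: "very_ample TYPE('k::field) n a (int d)"
  unfolding very_ample_def using sec_in_twist_sections sec_generates closed_immersion_sec by blast

end

text \<open>Supplies the enumeration \<open>expo\<close>: positive weights bound every exponent by
  \<open>d\<close>, so there are finitely many monomials of degree \<open>d\<close>.\<close>

lemma very_ample_of_bounds:
  assumes pos: "\<And>i. i \<le> n \<Longrightarrow> a i > 0" and d: "d > 0"
    and dvd: "\<And>i. i \<le> n \<Longrightarrow> a i dvd d"
    and le: "\<And>i j. i \<le> n \<Longrightarrow> j \<le> n \<Longrightarrow> a i \<noteq> a j \<Longrightarrow> a i * a j \<le> d"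
  shows "very_ample TYPE('k::field) n a (int d)"
proof -
  define M where "M = {m :: nat \<Rightarrow>\<^sub>0 nat. Poly_Mapping.keys m \<subseteq> {..n} \<and> wdeg a m = d}"
  have "finite M"
  proof (rule finite_imageD)
    have "Poly_Mapping.lookup ` M \<subseteq> {f. \<forall>x. (x \<in> {..n} \<longrightarrow> f x \<in> {..d}) \<and> (x \<notin> {..n} \<longrightarrow> f x = 0)}"
    proof (intro subsetI CollectI allI, elim imageE)
      fix f m x assume m: "f = Poly_Mapping.lookup m" "m \<in> M"
      then have "x \<le> n \<Longrightarrow> Poly_Mapping.lookup m x \<le> d"
        using mult_lookup_le_wdeg[of a x m] pos[of x]
        by (metis (mono_tags, lifting) M_def One_nat_def Suc_leI le_trans mem_Collect_eq mult_1 mult_le_mono1)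
      moreover have "\<not> x \<le> n \<Longrightarrow> Poly_Mapping.lookup m x = 0"
        using m(2) by (auto simp: M_def in_keys_iff)
      ultimately show "(x \<in> {..n} \<longrightarrow> f x \<in> {..d}) \<and> (x \<notin> {..n} \<longrightarrow> f x = 0)" using m(1) by auto
    qed
    then show "finite (Poly_Mapping.lookup ` M)"
      by (rule finite_subset) (rule finite_set_of_finite_funs; simp)
    show "inj_on Poly_Mapping.lookup M" by (auto simp: inj_on_def intro: poly_mapping_eqI)
  qed
  then obtain h where h: "h ` {..<card M} = M"
    using ex_bij_betw_nat_finite[of M] by (auto simp: bij_betw_def atLeast0LessThan)
  have x0: "Poly_Mapping.single 0 (d div a 0) \<in> M" using dvd[of 0] by (simp add: M_def)
  then have card: "card M > 0" using \<open>finite M\<close> card_gt_0_iff by blast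
  define N where "N = card M - 1"
  have N: "{..<card M} = {..N}" using card by (auto simp: N_def)
  \<comment> \<open>The default beyond \<open>N\<close> is the power of \<open>x_0\<close> of degree
    \<open>d\<close>, so the degree and variable conditions hold at every index.\<close>
  define expo where "expo j = (if j \<le> N then h j else Poly_Mapping.single 0 (d div a 0))" for j
  have im: "expo ` {..N} = M" unfolding expo_def using h N by (simp cong: image_cong_simp)
  have mem: "expo j \<in> M" for j
    using im x0 by (cases "j \<le> N") (auto simp: expo_def)
  interpret monomial_embedding n a d N expo
    by unfold_locales (use pos d dvd le im mem in \<open>auto simp: M_def\<close>)
  show ?thesis by (rule very_ample_degree)
qed

section \<open>Sheaves of negative degree\<close>

definition hom_ideal :: "nat \<Rightarrow> (nat \<Rightarrow> nat) \<Rightarrow> 'k::field mpol set \<Rightarrow> bool" where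
  "hom_ideal n a I \<longleftrightarrow> I \<subseteq> carrier (poly_ring n) \<and> 0 \<in> I \<and> (\<forall>f\<in>I. \<forall>g\<in>I. f + g \<in> I) \<and>
     (\<forall>f\<in>I. \<forall>g\<in>carrier (poly_ring n). f * g \<in> I) \<and> (\<forall>f\<in>I. \<forall>D. hom_comp a D f \<in> I)"

lemma hom_idealD:
  assumes "hom_ideal n a I"
  shows "I \<subseteq> carrier (poly_ring n)" "0 \<in> I" "f \<in> I \<Longrightarrow> g \<in> I \<Longrightarrow> f + g \<in> I"
    "f \<in> I \<Longrightarrow> g \<in> carrier (poly_ring n) \<Longrightarrow> f * g \<in> I" "f \<in> I \<Longrightarrow> hom_comp a D f \<in> I"
  using assms unfolding hom_ideal_def by meson+

text \<open>The sum of \<open>P\<close> and the principal ideal of \<open>f\<close> is again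
  homogeneous because \<open>f\<close> is.\<close>

lemma hom_ideal_adjoin:
  fixes P :: "'k::field mpol set"
  assumes P: "hom_ideal n a P" and f: "f \<in> graded_piece n a E"
  shows "hom_ideal n a {u + f * v | u v. u \<in> P \<and> v \<in> carrier (poly_ring n)}" (is "hom_ideal n a ?J")
  unfolding hom_ideal_def
proof (intro conjI ballI allI)
  note fc = graded_piece_carrier[OF f]
  have J: "u + f * v \<in> ?J" if "u \<in> P" "v \<in> carrier (poly_ring n)" for u v using that by blast
  show "?J \<subseteq> carrier (poly_ring n)"
    using hom_idealD(1)[OF P] fc by (auto intro!: poly_ring_add poly_ring_mult)
  show "0 \<in> ?J" using J[OF hom_idealD(2)[OF P] poly_ring_zero] by simp
  fix x assume "x \<in> ?J"
  then obtain u v where x: "x = u + f * v" "u \<in> P" "v \<in> carrier (poly_ring n)" by blast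
  {
    fix y :: "'k mpol" assume "y \<in> ?J"
    then obtain u' v' where y: "y = u' + f * v'" "u' \<in> P" "v' \<in> carrier (poly_ring n)" by blast
    have "x + y = (u + u') + f * (v + v')" by (simp add: x y algebra_simps)
    then show "x + y \<in> ?J" using J[OF hom_idealD(3)[OF P x(2) y(2)] poly_ring_add[OF x(3) y(3)]] by simp
  next
    fix g :: "'k mpol" assume g: "g \<in> carrier (poly_ring n)"
    have "x * g = u * g + f * (v * g)" by (simp add: x algebra_simps)
    then show "x * g \<in> ?J" using J[OF hom_idealD(4)[OF P x(2) g] poly_ring_mult[OF x(3) g]] by simp
  next
    fix D
    have "hom_comp a D x = hom_comp a D u + f * hom_comp a (D - E) v"
      using hom_comp_mult_graded[OF x(3) f, of D] by (simp add: x(1) hom_comp_add mult.commute)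
    then show "hom_comp a D x \<in> ?J"
      using J[OF hom_idealD(5)[OF P x(2)] hom_comp_carrier[OF x(3)]] by simp
  }
qed

text \<open>By Zorn, take \<open>P\<close> maximal among the homogeneous ideals that contain
  \<open>I\<close> and no power of \<open>x_i\<close>. Primality is needed for homogeneous elements
  only, and adjoining those does not leave the class of homogeneous ideals.\<close>

lemma homogeneous_prime_exists:
  fixes I :: "'k::field mpol set"
  assumes I: "hom_ideal n a I" and i: "i \<le> n" "a i > 0" and avoid: "\<And>k. var i ^ k \<notin> I"
  shows "\<exists>p\<in>wproj n a. I \<subseteq> p"
proof -
  define A where "A = {J. hom_ideal n a J \<and> I \<subseteq> J \<and> (\<forall>k. var i ^ k \<notin> J)}"
  have "\<exists>P\<in>A. \<forall>X\<in>A. P \<subseteq> X \<longrightarrow> X = P"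
  proof (rule subset_Zorn_nonempty)
    show "A \<noteq> {}" using I avoid by (auto simp: A_def)
    fix \<C> assume ne: "\<C> \<noteq> {}" and ch: "subset.chain A \<C>"
    have CA: "hom_ideal n a J" "I \<subseteq> J" "var i ^ k \<notin> J" if "J \<in> \<C>" for J k
      using ch that by (auto simp: subset.chain_def A_def)
    have "hom_ideal n a (\<Union>\<C>)"
      unfolding hom_ideal_def
    proof (intro conjI ballI allI)
      show "\<Union>\<C> \<subseteq> carrier (poly_ring n)" using hom_idealD(1)[OF CA(1)] by blast
      show "0 \<in> \<Union>\<C>" using hom_idealD(2)[OF CA(1)] ne by blast
      fix f assume f: "f \<in> \<Union>\<C>"
      then obtain J where J: "J \<in> \<C>" "f \<in> J" by blast
      show "f + g \<in> \<Union>\<C>" if "g \<in> \<Union>\<C>" for g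
      proof -
        obtain K where K: "K \<in> \<C>" "g \<in> K" using \<open>g \<in> \<Union>\<C>\<close> by blast
        have "J \<subseteq> K \<or> K \<subseteq> J" using ch J K by (auto simp: subset.chain_def)
        then show ?thesis using J K hom_idealD(3)[OF CA(1)] by blast
      qed
      show "f * g \<in> \<Union>\<C>" if "g \<in> carrier (poly_ring n)" for g
        using hom_idealD(4)[OF CA(1)[OF J(1)] J(2) that] J(1) by blast
      show "hom_comp a D f \<in> \<Union>\<C>" for D using hom_idealD(5)[OF CA(1)[OF J(1)] J(2)] J(1) by blast
    qed
    moreover have "I \<subseteq> \<Union>\<C>" using ne CA(2) by blast
    ultimately show "\<Union>\<C> \<in> A" using CA(3) by (auto simp: A_def)
  qed
  then obtain P where P: "P \<in> A" and max: "\<And>X. X \<in> A \<Longrightarrow> P \<subseteq> X \<Longrightarrow> X = P" by blast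
  have hP: "hom_ideal n a P" and IP: "I \<subseteq> P" and aP: "var i ^ k \<notin> P" for k using P by (auto simp: A_def)
  note P_D = hom_idealD[OF hP]
  \<comment> \<open>By maximality, the ideal obtained by adjoining \<open>f\<close> contains a power
    of \<open>x_i\<close>.\<close>
  have grow: "\<exists>k u v. var i ^ k = u + f * v \<and> u \<in> P \<and> v \<in> carrier (poly_ring n)"
    if f: "f \<in> graded_piece n a E" "f \<notin> P" for f E
  proof -
    let ?J = "{u + f * v | u v. u \<in> P \<and> v \<in> carrier (poly_ring n)}"
    have "u \<in> ?J" if "u \<in> P" for u
      using that poly_ring_zero[of n] by (intro CollectI exI[of _ u] exI[of _ 0]) simp
    moreover have "f \<in> ?J" using P_D(2) poly_ring_one[of n] by (intro CollectI exI[of _ 0] exI[of _ 1]) simp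
    ultimately have "P \<subseteq> ?J" "?J \<noteq> P" using f(2) by blast+
    then have "?J \<notin> A" using max by blast
    then show ?thesis using hom_ideal_adjoin[OF hP f(1)] IP \<open>P \<subseteq> ?J\<close> unfolding A_def by blast
  qed
  have "P \<in> wproj n a"
  proof (rule wprojI)
    show "var i \<notin> P" using aP[of 1] by simp
    show "f * g \<in> P" if "f \<in> P" "g \<in> carrier (poly_ring n)" for f g using P_D(4) that .
    fix f g D E assume f: "f \<in> graded_piece n a D" and g: "g \<in> graded_piece n a E" and fg: "f * g \<in> P"
    show "f \<in> P \<or> g \<in> P"
    proof (rule ccontr)
      assume "\<not> (f \<in> P \<or> g \<in> P)"
      then obtain k u v l u' v' where
        1: "var i ^ k = u + f * v" "u \<in> P" "v \<in> carrier (poly_ring n)" and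
        2: "var i ^ l = u' + g * v'" "u' \<in> P" "v' \<in> carrier (poly_ring n)"
        using grow[OF f] grow[OF g] by blast
      \<comment> \<open>In the product of the two expressions every summand has a factor in
        \<open>P\<close>, the last one being \<open>f * g\<close>.\<close>
      have "var i ^ (k + l) = u * (u' + g * v') + u' * (f * v) + f * g * (v * v')"
        by (simp only: power_add 1(1) 2(1)) (simp only: distrib_left distrib_right mult_ac add_ac)
      also have "\<dots> \<in> P"
      proof (intro P_D(3))
        have "u' + g * v' \<in> carrier (poly_ring n)"
          using 2 P_D(1) graded_piece_carrier[OF g] by (auto intro!: poly_ring_add poly_ring_mult)
        then show "u * (u' + g * v') \<in> P" by (rule P_D(4)[OF 1(2)])
        show "u' * (f * v) \<in> P" by (intro P_D(4)[OF 2(2)] poly_ring_mult graded_piece_carrier[OF f] 1(3))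
        show "f * g * (v * v') \<in> P" by (intro P_D(4)[OF fg] poly_ring_mult 1(3) 2(3))
      qed
      finally show False using aP by blast
    qed
  qed (use P_D i in auto)
  then show ?thesis using IP by blast
qed

section \<open>Global sections in negative degree\<close>

lemma zero_in_wproj:
  assumes "a 0 > 0"
  shows "{0} \<in> wproj n a"
proof (rule wprojI)
  show "var 0 \<notin> {0}" using var_power_nonzero[of 0 1] by (simp del: One_nat_def)
qed (use assms in \<open>auto simp: poly_ring_zero\<close>)

text \<open>The denominators of \<open>h\<close> form a homogeneous ideal. Without a power of
  \<open>x_i\<close> it would lie in some point \<open>p\<close>, yet \<open>h\<close> has a
  denominator outside \<open>p\<close>.\<close>

lemma global_fraction_denominator:
  assumes i: "i \<le> n" "a i > 0" and h: "\<And>p. p \<in> wproj n a \<Longrightarrow> h \<in> stalk n a D p"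
  shows "\<exists>k. \<exists>F \<in> graded_piece n a (int (a i * k) + D). Fraction_Field.Fract (var i ^ k) 1 * h = Fraction_Field.Fract F 1"
proof -
  let ?e = "\<lambda>f. Fraction_Field.Fract f 1"
  have inj: "f = g" if "?e f = ?e g" for f g :: "'a mpol" using that by (simp add: eq_fract)
  define I where "I = {g \<in> carrier (poly_ring n). \<exists>f\<in>carrier (poly_ring n). ?e g * h = ?e f}"
  show ?thesis
  proof (cases "\<exists>p :: 'a mpol set. p \<in> wproj n a")
    case False
    have "hom_ideal n a ({0} :: 'a mpol set)" by (auto simp: hom_ideal_def poly_ring_zero)
    then show ?thesis
      \<comment> \<open>A point is needed to write \<open>h\<close> as a fraction at all; the zero
        ideal leads to one.\<close>
      using homogeneous_prime_exists[of n a "{0} :: 'a mpol set" i] i False var_power_nonzero by blast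
  next
    case True
    then obtain p0 :: "'a mpol set" where p0: "p0 \<in> wproj n a" ..
    obtain f0 g0 E where h0: "h = Fraction_Field.Fract f0 g0" "f0 \<in> graded_piece n a (E + D)" "g0 \<in> graded_piece n a E" "g0 \<notin> p0"
      using h[OF p0] unfolding stalk_def by blast
    have g0: "g0 \<noteq> 0" using h0(4) zero_mem_wproj[OF p0] by blast
    \<comment> \<open>With one fixed fraction \<open>f0 / g0\<close> for \<open>h\<close>,
      conditions on \<open>h\<close> become polynomial identities that can be split into
      components.\<close>
    have rel: "?e g * h = ?e f \<longleftrightarrow> g * f0 = f * g0" for g f
      unfolding h0(1) using g0 by (simp add: eq_fract)
    have comp: "hom_comp a K g * f0 = hom_comp a (K + D) f * g0"
      if "g \<in> carrier (poly_ring n)" "f \<in> carrier (poly_ring n)" "g * f0 = f * g0" for g f K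
      using hom_comp_mult_graded[OF that(1) h0(2), of "K + E + D"] hom_comp_mult_graded[OF that(2) h0(3), of "K + E + D"]
        that(3) by (simp add: algebra_simps)
    have "hom_ideal n a I"
      unfolding hom_ideal_def
    proof (intro conjI ballI allI)
      show "I \<subseteq> carrier (poly_ring n)" by (auto simp: I_def)
      show "0 \<in> I" unfolding I_def rel using poly_ring_zero[of n] by force
      fix g assume "g \<in> I"
      then obtain f where g: "g \<in> carrier (poly_ring n)" "f \<in> carrier (poly_ring n)" "g * f0 = f * g0"
        unfolding I_def rel by blast
      show "g + g' \<in> I" if g'I: "g' \<in> I" for g'
      proof -
        obtain f' where g': "g' \<in> carrier (poly_ring n)" "f' \<in> carrier (poly_ring n)" "g' * f0 = f' * g0"
          using g'I unfolding I_def rel by blast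
        have "(g + g') * f0 = (f + f') * g0" by (simp only: distrib_right g g')
        then show ?thesis unfolding I_def rel using poly_ring_add[OF g(1) g'(1)] poly_ring_add[OF g(2) g'(2)] by blast
      qed
      show "g * v \<in> I" if v: "v \<in> carrier (poly_ring n)" for v
      proof -
        have "(g * v) * f0 = (g * f0) * v" by (simp only: mult_ac)
        also have "\<dots> = (f * v) * g0" by (simp only: g(3)) (simp only: mult_ac)
        finally show ?thesis unfolding I_def rel using poly_ring_mult[OF g(1) v] poly_ring_mult[OF g(2) v] by blast
      qed
      show "hom_comp a K g \<in> I" for K
        unfolding I_def rel using comp[OF g] hom_comp_carrier[OF g(1)] hom_comp_carrier[OF g(2)] by blast
    qed
    moreover have "\<not> I \<subseteq> p" if p: "p \<in> wproj n a" for p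
    proof -
      obtain f g e where fg: "h = Fraction_Field.Fract f g" "f \<in> graded_piece n a (e + D)" "g \<in> graded_piece n a e" "g \<notin> p"
        using h[OF p] unfolding stalk_def by blast
      have "g \<noteq> 0" using fg(4) zero_mem_wproj[OF p] by blast
      then have "?e g * h = ?e f" by (simp add: fg(1) eq_fract)
      then have "g \<in> I" unfolding I_def using fg graded_piece_carrier by blast
      then show ?thesis using fg(4) by blast
    qed
    ultimately obtain k where k: "var i ^ k \<in> I" using homogeneous_prime_exists[of n a I i] i by blast
    then obtain F where F: "F \<in> carrier (poly_ring n)" "var i ^ k * f0 = F * g0" unfolding I_def rel by blast
    have xg: "(var i :: 'a mpol) ^ k \<in> graded_piece n a (int (a i * k))" by (rule var_power_graded[OF i(1) refl])
    have "F \<in> graded_piece n a (int (a i * k) + D)"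
    proof (rule graded_pieceI[OF F(1)])
      fix K assume K: "K \<noteq> int (a i * k) + D"
      have "hom_comp a (K - D) (var i ^ k) * f0 = hom_comp a K F * g0"
        using comp[OF graded_piece_carrier[OF xg] F, of "K - D"] by simp
      moreover have "hom_comp a (K - D) (var i ^ k :: 'a mpol) = 0"
        using K by (simp only: hom_comp_of_graded[OF xg]) auto
      ultimately show "hom_comp a K F = 0" using g0 by simp
    qed
    then show ?thesis using F(2) rel by (intro exI[of _ k] bexI[of _ F]) simp_all
  qed
qed

lemma keys_mult_single:
  "m \<in> Poly_Mapping.keys F \<Longrightarrow> m + v \<in> Poly_Mapping.keys (F * Poly_Mapping.single v 1 :: 'k::field mpol)"
proof -
  assume "m \<in> Poly_Mapping.keys F"
  have "F * Poly_Mapping.single v 1 = (\<Sum>u\<in>Poly_Mapping.keys F. Poly_Mapping.single (u + v) (Poly_Mapping.lookup F u))"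
    by (subst poly_mapping_single_sum[of F]) (simp add: sum_distrib_right mult_single)
  then have "Poly_Mapping.lookup (F * Poly_Mapping.single v 1) (m + v) = Poly_Mapping.lookup F m"
    using \<open>m \<in> _\<close> by (simp add: lookup_sum lookup_single when_def sum.delta')
  then show "m + v \<in> Poly_Mapping.keys (F * Poly_Mapping.single v 1)"
    using \<open>m \<in> _\<close> by (simp add: in_keys_iff)
qed

text \<open>Write \<open>h = F / x_0^k = G / x_1^l\<close>. By \<open>F * x_1^l = G * x_0^k\<close>,
  each monomial of \<open>F\<close> is divisible by \<open>x_0^k\<close>, so its degree is at least
  \<open>a 0 * k\<close>, which exceeds the degree \<open>a 0 * k + D\<close> of
  \<open>F\<close>.\<close>

lemma global_fraction_negative:
  fixes h :: "'k::field mpol fract"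
  assumes n: "n \<ge> 1" and pos: "\<And>i. i \<le> n \<Longrightarrow> a i > 0" and D: "D < 0"
    and h: "\<And>p. p \<in> wproj n a \<Longrightarrow> h \<in> stalk n a D p"
  shows "h = 0"
proof -
  let ?e = "\<lambda>f :: 'k mpol. Fraction_Field.Fract f 1"
  obtain k F where F: "F \<in> graded_piece n a (int (a 0 * k) + D)" "?e (var 0 ^ k) * h = ?e F"
    using global_fraction_denominator[OF _ _ h, of 0] pos[of 0] by auto
  obtain l G where G: "G \<in> graded_piece n a (int (a 1 * l) + D)" "?e (var 1 ^ l) * h = ?e G"
    using global_fraction_denominator[OF _ _ h, of 1] pos[of 1] n by auto
  have "?e (F * var 1 ^ l) = ?e (var 0 ^ k) * h * ?e (var 1 ^ l)" by (simp only: F(2) mult_fract mult_1_right)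
  also have "\<dots> = ?e (var 1 ^ l) * h * ?e (var 0 ^ k)" by (simp only: mult_ac)
  also have "\<dots> = ?e (G * var 0 ^ k)" by (simp only: G(2) mult_fract mult_1_right)
  finally have eq: "F * var 1 ^ l = G * var 0 ^ k" by (simp add: eq_fract)
  have "m \<notin> Poly_Mapping.keys F" for m
  proof
    assume m: "m \<in> Poly_Mapping.keys F"
    have "m + Poly_Mapping.single 1 l \<in> Poly_Mapping.keys (G * var 0 ^ k)"
      using keys_mult_single[OF m, of "Poly_Mapping.single 1 l"] by (simp only: eq[unfolded var_power] var_power)
    then obtain u v where "m + Poly_Mapping.single 1 l = u + v" "v \<in> Poly_Mapping.keys (var 0 ^ k :: 'k mpol)"
      using keys_mult by blast
    then have "m + Poly_Mapping.single 1 l = u + Poly_Mapping.single 0 k" unfolding var_power by simp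
    \<comment> \<open>Compare exponents of \<open>x_0\<close>, to which \<open>x_1^l\<close>
      contributes nothing.\<close>
    then have "Poly_Mapping.lookup (m + Poly_Mapping.single 1 l) 0 = Poly_Mapping.lookup (u + Poly_Mapping.single 0 k) 0"
      by simp
    then have "k \<le> Poly_Mapping.lookup m 0" by (simp add: lookup_add lookup_single)
    then have "a 0 * k \<le> wdeg a m" using mult_lookup_le_wdeg[of a 0 m] by (meson le_trans mult_le_mono2)
    moreover have "int (wdeg a m) = int (a 0 * k) + D" using F(1) m by (simp add: graded_piece_iff)
    ultimately show False using D by linarith
  qed
  then have "F = 0" by (metis all_not_in_conv keys_eq_empty)
  then have "?e (var 0 ^ k) * h = 0" using F(2) by (simp add: Zero_fract_def)
  moreover have "?e (var 0 ^ k) \<noteq> 0" using var_power_nonzero[of 0 k] by (simp add: Zero_fract_def eq_fract)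
  ultimately show "h = 0" by simp
qed

text \<open>Every nonempty open set contains the generic point, so a section is constant as an element of the field of fractions.\<close>

lemma twist_section_constant:
  assumes s: "s \<in> twist_sections n a D (wproj n a)" and a0: "a 0 > 0" and p: "p \<in> wproj n a"
  shows "s p = s {0}"
proof -
  from s have "\<forall>p\<in>wproj n a. \<exists>V. openin (zariski n a) V \<and> p \<in> V \<and> V \<subseteq> wproj n a \<and>
      (\<exists>e. \<exists>f\<in>graded_piece n a (e + D). \<exists>g\<in>graded_piece n a e. \<forall>q\<in>V. g \<notin> q \<and> s q = Fraction_Field.Fract f g)"
    unfolding twist_sections_def mem_Collect_eq by (rule conjunct2)
  from bspec[OF this p] obtain V f g where
    V: "openin (zariski n a) V" "p \<in> V" "\<forall>q\<in>V. g \<notin> q \<and> s q = Fraction_Field.Fract f g"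
    by (elim exE conjE bexE)
  then obtain T where T: "T \<subseteq> carrier (poly_ring n)" "V = {p \<in> wproj n a. \<not> T \<subseteq> p}"
    unfolding openin_zariski zariski_open_def by blast
  have "{0} \<in> V" using V(2) zero_mem_wproj[OF p] zero_in_wproj[of a n, OF a0] unfolding T(2) by blast
  then show ?thesis using V by simp
qed

text \<open>All global sections vanish, so they cannot generate the nonzero element
  \<open>1 / x_0^(d / a_0)\<close> of the stalk at the generic point.\<close>

lemma not_very_ample_negative:
  assumes n: "n \<ge> 1" and pos: "\<And>i. i \<le> n \<Longrightarrow> a i > 0" and d: "d > 0" "a 0 dvd d"
  shows "\<not> very_ample TYPE('k::field) n a (- int d)"
proof
  assume "very_ample TYPE('k) n a (- int d)"
  then obtain N and s :: "nat \<Rightarrow> 'k mpol set \<Rightarrow> 'k mpol fract" where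
    s: "\<forall>j\<le>N. s j \<in> twist_sections n a (- int d) (wproj n a)" and gen: "generates n a (- int d) N s"
    unfolding very_ample_def by blast
  have z: "{0} \<in> wproj n a" using zero_in_wproj pos by blast
  have s0: "s j {0} = 0" if j: "j \<le> N" for j
  proof (rule global_fraction_negative[OF n pos])
    fix p :: "'k mpol set" assume p: "p \<in> wproj n a"
    have "s j p = s j {0}" using twist_section_constant[OF _ _ p] s j pos by blast
    moreover have "s j p \<in> stalk n a (- int d) p" using s j p unfolding twist_sections_def by blast
    ultimately show "s j {0} \<in> stalk n a (- int d) p" by simp
  qed (use d in auto)
  define x :: "'k mpol" where "x = var 0 ^ (d div a 0)"
  have x: "x \<in> graded_piece n a (int d)" unfolding x_def using d by (intro var_power_graded) auto
  have x0: "x \<noteq> 0" unfolding x_def by (rule var_power_nonzero)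
  have "Fraction_Field.Fract 1 x \<in> stalk n a (- int d) {0}"
    unfolding stalk_def using x x0 graded_piece_one[of n a] by force
  then obtain u where "Fraction_Field.Fract 1 x = (\<Sum>j\<le>N. u j * s j {0})"
    using gen z unfolding generates_def by blast
  then have "Fraction_Field.Fract 1 x = 0" using s0 by simp
  then show False using x0 by (simp add: Zero_fract_def eq_fract)
qed

section \<open>Pairwise equal or coprime weights\<close>

lemma weight_lcm_pos: "\<forall>i\<le>n. a i > 0 \<Longrightarrow> weight_lcm n a > 0"
  unfolding weight_lcm_def by (rule Nat.gr0I) (force simp: Lcm_0_iff)

text \<open>Different weights are coprime divisors of the lcm, so their product divides it.\<close>

lemma weight_mult_le_lcm:
  assumes "\<forall>i\<le>n. a i > 0" "\<forall>i\<le>n. \<forall>j\<le>n. a i \<noteq> a j \<longrightarrow> gcd (a i) (a j) = 1" "i \<le> n" "j \<le> n" "a i \<noteq> a j"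
  shows "a i * a j \<le> weight_lcm n a"
proof (rule dvd_imp_le)
  show "weight_lcm n a > 0"
    using assms(1) by (rule weight_lcm_pos)
  show "a i * a j dvd weight_lcm n a"
    using assms by (intro divides_mult) (auto simp: weight_lcm_def coprime_iff_gcd_eq_1)
qed

theorem theorem1p1:
  fixes n :: nat and a :: "nat \<Rightarrow> nat"
  assumes "\<forall>i\<le>n. a i > 0"
    and "well_formed n a"
    and "\<forall>i\<le>n. \<forall>j\<le>n. a i \<noteq> a j \<longrightarrow> gcd (a i) (a j) = 1"
  shows "mu_va TYPE('k::field) n a = 1 \<and>
    (\<forall>m::int. ample TYPE('k) n a (m * int (weight_lcm n a)) \<longrightarrow>
              very_ample TYPE('k) n a (m * int (weight_lcm n a)))"
proof -
  let ?L = "weight_lcm n a"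
  have n: "n \<ge> 1" using assms(2) by (cases n) (auto simp: well_formed_def)
  have L: "?L > 0" using assms(1) by (rule weight_lcm_pos)
  have dvd: "a i dvd ?L" if "i \<le> n" for i using that by (simp add: weight_lcm_def)
  have va: "very_ample TYPE('k) n a (int (k * ?L))" if "k \<ge> 1" for k
  proof (rule very_ample_of_bounds)
    show "a i * a j \<le> k * ?L" if "i \<le> n" "j \<le> n" "a i \<noteq> a j" for i j
      using weight_mult_le_lcm[OF assms(1,3) that] \<open>k \<ge> 1\<close> by (metis le_trans mult_le_mono1 nat_mult_1)
  qed (use assms(1) L dvd that in auto)
  have "mu_va TYPE('k) n a = 1"
    unfolding mu_va_def using va[of 1] by (intro Least_equality) auto
  moreover have "very_ample TYPE('k) n a (m * int ?L)" if am: "ample TYPE('k) n a (m * int ?L)" for m :: int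
  proof -
    obtain r where r: "r \<ge> 1" "very_ample TYPE('k) n a (int r * (m * int ?L))"
      using am unfolding ample_def by blast
    consider "m > 0" | "m = 0" | "m < 0" by linarith
    then show ?thesis
    proof cases
      case 1
      then show ?thesis using va[of "nat m"] by simp
    next
      case 2
      \<comment> \<open>All powers of \<open>O(0)\<close> are \<open>O(0)\<close>, so here ampleness
        is very ampleness.\<close>
      then show ?thesis using r(2) by simp
    next
      case 3
      \<comment> \<open>The power of the bundle that is assumed very ample has negative degree,
        which is contradictory.\<close>
      have "int r * (m * int ?L) = - int (r * nat (- m) * ?L)" using 3 by simp
      moreover have "\<not> very_ample TYPE('k) n a (- int (r * nat (- m) * ?L))"
        by (rule not_very_ample_negative) (use n assms(1) r(1) 3 L dvd[of 0] in auto)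
      ultimately show ?thesis using r(2) by simp
    qed
  qed
  ultimately show ?thesis by blast
qed

end
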